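(* Let $n \geq 2$, and let $T \subset \mathbb{R}^n$ be a closed set which meets every sphere $\{x \in \mathbb{R}^n : |x| = r\}$ centred at the origin of radius $r \geq 0$. Then, for each $d \in \mathbb{N}$, there exists a quasiregular map $h:\mathbb{R}^n \to \mathbb{R}^n$, of polynomial type and of degree $d^{n-1}$, for which $\mathcal{M}(h) = T$.
   Context: Here $\mathbb{N}$ is the set of positive integers and $|\cdot|$ is the Euclidean norm; a singleton is regarded as a (degenerate) sphere of radius zero, so the hypothesis with $r=0$ says $0 \in T$. Quasiregular maps are understood in the standard sense: a continuous map $f:\mathbb{R}^n \to \mathbb{R}^n$ in the Sobolev space $W^{1,n}_{\mathrm{loc}}$ is quasiregular if there is $K_0 \geq 1$ with $|Df(x)|^n \leq K_0 J_f(x)$ for almost every $x$, where $|Df(x)|$ is the operator norm of the derivative and $J_f$ is the Jacobian determinant. A (non-constant) quasiregular map $f:\mathbb{R}^n\to\mathbb{R}^n$ is of polynomial type if it has finite degree, where the degree is the maximal number of preimages of a point, $\max_{y} \#f^{-1}(y)$; otherwise it is of transcendental type. For a quasiregular map $f : \mathbb{R}^n \to \mathbb{R}^n$, the maximum modulus function is $M(r,f) = \max_{|x|=r} |f(x)|$ for $r \geq 0$, and the maximum modulus set is $\mathcal{M}(f) = \{ x \in \mathbb{R}^n : |f(x)| = M(|x|,f) \}$. *)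

theory Defs
  imports "HOL-Analysis.Analysis" "HOL-Library.Extended_Nat"
begin

definition partial :: "'n::finite \<Rightarrow> (real^'n \<Rightarrow> real) \<Rightarrow> real^'n \<Rightarrow> real" where
  "partial j \<phi> x = frechet_derivative \<phi> (at x) (axis j 1)"

primrec C_k :: "nat \<Rightarrow> (real^'n::finite \<Rightarrow> real) \<Rightarrow> bool" where
  "C_k 0 \<phi> \<longleftrightarrow> continuous_on UNIV \<phi>"
| "C_k (Suc k) \<phi> \<longleftrightarrow> (\<forall>x. \<phi> differentiable (at x)) \<and> (\<forall>j. C_k k (partial j \<phi>))"

definition test_function :: "(real^'n::finite \<Rightarrow> real) \<Rightarrow> bool" where
  "test_function \<phi> \<longleftrightarrow> (\<forall>k. C_k k \<phi>) \<and> compact (closure {x. \<phi> x \<noteq> 0})"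

definition L_loc :: "nat \<Rightarrow> ('a::euclidean_space \<Rightarrow> 'b::euclidean_space) \<Rightarrow> bool" where
  "L_loc p f \<longleftrightarrow> f \<in> borel_measurable lebesgue \<and>
     (\<forall>C. compact C \<longrightarrow> set_integrable lebesgue C (\<lambda>x. norm (f x) ^ p))"

(* The matrix entry D x $ i $ j is the weak partial derivative of the i-th component of f
   in the j-th direction, so D x is the usual Jacobian matrix, acting by D x *v v. *)
definition weak_derivative ::
  "(real^'n::finite \<Rightarrow> real^'m::finite) \<Rightarrow> (real^'n \<Rightarrow> real^'n^'m) \<Rightarrow> bool" where
  "weak_derivative f D \<longleftrightarrow>
     (\<forall>\<phi> i j. test_function \<phi> \<longrightarrow>
        (LINT x|lebesgue. f x $ i * partial j \<phi> x) = - (LINT x|lebesgue. D x $ i $ j * \<phi> x))"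

(* f belongs to W^{1,p}_loc, with weak derivative D (unique up to a null set). *)
definition W1_loc ::
  "nat \<Rightarrow> (real^'n::finite \<Rightarrow> real^'m::finite) \<Rightarrow> (real^'n \<Rightarrow> real^'n^'m) \<Rightarrow> bool" where
  "W1_loc p f D \<longleftrightarrow> L_loc p f \<and> L_loc p D \<and> weak_derivative f D"

definition quasiregular :: "(real^'n::finite \<Rightarrow> real^'n) \<Rightarrow> bool" where
  "quasiregular f \<longleftrightarrow> continuous_on UNIV f \<and>
     (\<exists>D. W1_loc CARD('n) f D \<and>
        (\<exists>K\<ge>1. AE x in lebesgue. onorm ((*v) (D x)) ^ CARD('n) \<le> K * det (D x)))"

(* A supremum in enat: it is the maximal number of preimages of a point when these numbers are
   bounded, and \<infinity> otherwise (also if all fibres are finite but of unbounded size). *)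
definition mapping_degree :: "('a \<Rightarrow> 'b) \<Rightarrow> enat" where
  "mapping_degree f = (SUP y. if finite (f -` {y}) then enat (card (f -` {y})) else \<infinity>)"

definition polynomial_type :: "(real^'n::finite \<Rightarrow> real^'n) \<Rightarrow> bool" where
  "polynomial_type f \<longleftrightarrow>
     quasiregular f \<and> \<not> f constant_on UNIV \<and> mapping_degree f < \<infinity>"

(* For r >= 0 and continuous f the supremum is attained, since the sphere is compact and nonempty;
   note that sphere 0 0 = {0}. *)
definition max_modulus :: "real \<Rightarrow> (real^'n::finite \<Rightarrow> real^'n) \<Rightarrow> real" where
  "max_modulus r f = (SUP x\<in>sphere 0 r. norm (f x))"

definition max_modulus_set :: "(real^'n::finite \<Rightarrow> real^'n) \<Rightarrow> (real^'n) set" where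
  "max_modulus_set f = {x. norm (f x) = max_modulus (norm x) f}"

end

theory Submission
  imports Defs
begin

text \<open>
The map is written down explicitly. Put $N = d^{n-1}$ and let $P$ be the $N$-fold winding map that
multiplies the polar angle in one fixed coordinate plane by $N$ and leaves the other coordinates
alone. It preserves the Euclidean norm, is homogeneous of degree one and Lipschitz, its Jacobian
determinant equals $N$ off the codimension-two subspace where the two chosen coordinates vanish,
and a point has exactly $N$ preimages if it lies off that subspace and one otherwise. In particular
a single winding realises every degree.

The maximum modulus set is then created by damping $P$ radially. Let $g \ge 0$ be a differentiable
function that vanishes exactly on $T$ and whose gradient is bounded by a small $\epsilon$, and set
\[ h(x) = \Bigl(1 - \frac{g(x)}{|x|}\Bigr) P(x), \qquad h(0) = 0. \]
Since $|h(x)| = |x| - g(x)$ and $T$ meets every sphere, the maximum of $|h|$ on the sphere of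
radius $r$ is $r$, and it is attained exactly at the points of $T$. Along every ray
$t \mapsto |h(tx)|$ increases strictly from $0$ to $\infty$, so the fibres of $h$ have as many
points as those of $P$, and the degree is $N$.

For quasiregularity, $h$ is Lipschitz and differentiable almost everywhere. Its derivative is
$DP(x) \circ B$, where homogeneity of $P$ allows the derivative of the damping factor to be absorbed
into a linear map $B$ within distance $3\epsilon$ of the identity. So for small $\epsilon$ the
Jacobian determinant is at least $N/2$, while the operator norm is at most the Lipschitz constant.

Choosing $g$ differentiable, and not merely the Lipschitz function given by the distance to $T$,
makes $h$ differentiable at every point off the subspace without an appeal to Rademacher's theorem.
That the almost everywhere derivative of a Lipschitz function is its weak derivative is
\<open>lipschitz_imp_W1_loc\<close>; the zero set is prescribed in \<open>closed_set_as_zero_set\<close>; the winding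
map is studied in \<open>has_derivative_wind\<close>, \<open>card_wind_fibre\<close> and \<open>det_plane_map\<close>; and the damping in
the locale \<open>radial_damping\<close>.
\<close>

section \<open>Closed sets as zero sets of differentiable functions with small gradient\<close>

text \<open>
Squaring removes the corner of the positive part at zero, which is why the bump functions below
are squares.
\<close>
lemma has_derivative_power2_pos_part:
  fixes f :: "'a::real_normed_vector \<Rightarrow> real"
  assumes "(f has_derivative f') (at x)"
  shows "((\<lambda>x. (max 0 (f x))\<^sup>2) has_derivative (\<lambda>v. 2 * max 0 (f x) * f' v)) (at x)"
proof -
  have "((\<lambda>t::real. (max 0 t)\<^sup>2) has_real_derivative 2 * max 0 t) (at t)" for t
  proof (cases "t = 0")
    case True
    have "norm ((max 0 h)\<^sup>2 / h) \<le> norm h" for h :: real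
      by (cases "h \<le> 0") (auto simp: max_def power2_eq_square)
    then have "((\<lambda>h::real. (max 0 h)\<^sup>2 / h) \<longlongrightarrow> 0) (at 0)"
      by (rule Lim_null_comparison[OF always_eventually[OF allI] tendsto_norm_zero[OF tendsto_ident_at]])
    then show ?thesis
      using True by (simp add: DERIV_def)
  next
    case False
    show ?thesis
    proof (cases "t < 0")
      case True
      have "((\<lambda>t::real. 0) has_real_derivative 2 * max 0 t) (at t)"
        using True by (auto simp: max_def)
      then show ?thesis
        by (rule has_field_derivative_transform_within_open[where S = "{..<0}"]) (use True in auto)
    next
      case f2: False
      have "((\<lambda>t::real. t\<^sup>2) has_real_derivative 2 * max 0 t) (at t)"
        using f2 by (auto simp: max_def intro!: derivative_eq_intros)
      then show ?thesis
        by (rule has_field_derivative_transform_within_open[where S = "{0<..}"]) (use f2 False in auto)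
    qed
  qed
  from has_derivative_compose[OF assms this[unfolded has_field_derivative_def]]
  show ?thesis by simp
qed

definition bump :: "'a::real_inner \<Rightarrow> real \<Rightarrow> 'a \<Rightarrow> real" where
  "bump c r x = (max 0 (r\<^sup>2 - (norm (x - c))\<^sup>2))\<^sup>2"

definition bump_grad :: "'a::real_inner \<Rightarrow> real \<Rightarrow> 'a \<Rightarrow> 'a" where
  "bump_grad c r x = - (4 * max 0 (r\<^sup>2 - (norm (x - c))\<^sup>2)) *\<^sub>R (x - c)"

text \<open>
The zero set of a bump is exactly the complement of the open ball, so a positive combination of
bumps vanishes exactly off the union of the balls.
\<close>
lemma bump_eq_0_iff: "r \<ge> 0 \<Longrightarrow> bump c r x = 0 \<longleftrightarrow> x \<notin> ball c r"
  using power_mono_iff[of r "norm (x - c)" 2]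
  by (auto simp: bump_def max_def dist_norm norm_minus_commute not_le)

lemma bump_nonneg: "bump c r x \<ge> 0"
  by (simp add: bump_def)

lemma has_derivative_bump: "(bump c r has_derivative (\<lambda>v. bump_grad c r x \<bullet> v)) (at x)"
proof -
  have "((\<lambda>x. r\<^sup>2 - (norm (x - c))\<^sup>2) has_derivative (\<lambda>v. - (2 * ((x - c) \<bullet> v)))) (at x)"
    unfolding power2_norm_eq_inner
    by (auto intro!: derivative_eq_intros simp: inner_commute)
  from has_derivative_power2_pos_part[OF this] show ?thesis
    by (simp add: bump_def[abs_def] bump_grad_def algebra_simps)
qed

lemma bump_le_1:
  assumes "0 \<le> r" "r \<le> 1"
  shows "bump c r x \<le> 1"
proof -
  have "max 0 (r\<^sup>2 - (norm (x - c))\<^sup>2) \<le> 1"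
    using power_le_one[OF assms, of 2] zero_le_power2[of "norm (x - c)"] by linarith
  then show ?thesis
    unfolding bump_def by (intro power_le_one) auto
qed

text \<open>
The gradient is bounded by $4 r^3$; restricting to $r \le 1$ gives one constant for all bumps.
\<close>
lemma norm_bump_grad_le:
  assumes "0 \<le> r" "r \<le> 1"
  shows "norm (bump_grad c r x) \<le> 4"
proof (cases "norm (x - c) \<le> r")
  case True
  then have "0 \<le> r\<^sup>2 - (norm (x - c))\<^sup>2" "r\<^sup>2 - (norm (x - c))\<^sup>2 \<le> 1"
    using power_le_one[OF assms, of 2] zero_le_power2[of "norm (x - c)"] power_mono[OF True, of 2]
    by (simp, linarith)
  then have "norm (bump_grad c r x) \<le> (4 * 1) * 1"
    unfolding bump_grad_def norm_scaleR
    using True assms by (intro mult_mono) auto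
  then show ?thesis by simp
next
  case False
  then have "r\<^sup>2 - (norm (x - c))\<^sup>2 \<le> 0"
    using assms by (simp add: power_mono)
  then show ?thesis by (simp add: bump_grad_def)
qed

text \<open>
Lindelof's theorem; the radius bound keeps the gradients of the bumps uniformly bounded. Radius
zero is admitted so that the empty set needs no separate treatment: the list of balls is padded
by an empty one.
\<close>
lemma open_as_countable_union_of_balls:
  fixes U :: "'a::euclidean_space set"
  assumes "open U"
  obtains c :: "nat \<Rightarrow> 'a" and r :: "nat \<Rightarrow> real"
  where "\<And>k. 0 \<le> r k" "\<And>k. r k \<le> 1" "(\<Union>k. ball (c k) (r k)) = U"
proof -
  define I where "I = {p :: 'a \<times> real. 0 \<le> snd p \<and> snd p \<le> 1 \<and> ball (fst p) (snd p) \<subseteq> U}"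
  define B where "B p = ball (fst p) (snd p)" for p :: "'a \<times> real"
  obtain F where F: "F \<subseteq> B ` I" "countable F" "\<Union>F = \<Union>(B ` I)"
    by (rule Lindelof[of "B ` I"]) (auto simp: B_def)
  then obtain J where J: "countable J" "J \<subseteq> I" "F = B ` J"
    using countable_subset_image by metis
  have I_Un: "\<Union>(B ` I) = U"
  proof
    show "U \<subseteq> \<Union>(B ` I)"
    proof
      fix x assume "x \<in> U"
      then obtain e where "e > 0" "ball x e \<subseteq> U"
        using assms open_contains_ball by blast
      then have "(x, min e 1) \<in> I" "x \<in> B (x, min e 1)"
        by (auto simp: I_def B_def)
      then show "x \<in> \<Union>(B ` I)" by blast
    qed
  qed (auto simp: I_def B_def)
  define p where "p = from_nat_into (insert (0, 0) J)"
  have rp: "range p = insert (0, 0) J"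
    unfolding p_def using J(1) by (intro range_from_nat_into) auto
  have "(0, 0) \<in> I" by (auto simp: I_def)
  have pI: "p k \<in> I" for k
  proof -
    have "p k \<in> insert (0, 0) J"
      unfolding rp[symmetric] by simp
    then show ?thesis
      using J(2) \<open>(0, 0) \<in> I\<close> by (metis insertE subsetD)
  qed
  have "(\<Union>k. B (p k)) = \<Union>(B ` insert (0, 0) J)"
    unfolding rp[symmetric] by (simp add: image_image)
  also have "\<dots> = U"
    unfolding image_insert Union_insert J(3)[symmetric] F(3) I_Un by (simp add: B_def)
  finally show ?thesis
    using that[of "\<lambda>k. snd (p k)" "\<lambda>k. fst (p k)"] pI unfolding I_def B_def by blast
qed

text \<open>
Cover the complement of $T$ by balls of radius at most one and sum the corresponding bumps with
weights $w_k = \epsilon\, 2^{-k-1}/4$. The gradients are at most $4$, so the series of derivatives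
converges uniformly, which makes the sum differentiable with gradient at most
$\sum_k 4 w_k = \epsilon$. All terms are nonnegative, hence the sum vanishes only where every
bump does.
\<close>
lemma closed_set_as_zero_set:
  fixes T :: "'a::euclidean_space set"
  assumes "closed T" "\<epsilon> > 0"
  obtains g :: "'a \<Rightarrow> real" and g' :: "'a \<Rightarrow> 'a \<Rightarrow> real"
  where "\<And>x. (g has_derivative g' x) (at x)" "\<And>x v. \<bar>g' x v\<bar> \<le> \<epsilon> * norm v"
    "\<And>x. 0 \<le> g x" "\<And>x. g x = 0 \<longleftrightarrow> x \<in> T"
proof -
  obtain c :: "nat \<Rightarrow> 'a" and r where r: "\<And>k. 0 \<le> r k" "\<And>k. r k \<le> 1" and Un: "(\<Union>k. ball (c k) (r k)) = - T"
    by (rule open_as_countable_union_of_balls[of "- T"]) (use assms in auto)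
  define w :: "nat \<Rightarrow> real" where "w k = \<epsilon> / 4 * (1/2) ^ Suc k" for k
  have w_pos: "w k > 0" for k using assms by (simp add: w_def)
  have w_sums: "w sums (\<epsilon> / 4)"
    using sums_mult[OF power_half_series, of "\<epsilon> / 4"] by (simp add: w_def[abs_def])
  define f where "f k x = w k * bump (c k) (r k) x" for k x
  define f' where "f' k x v = w k * (bump_grad (c k) (r k) x \<bullet> v)" for k x v
  have f_le: "norm (f k x) \<le> w k" for k x
    using bump_le_1[OF r, of "c k" k x] bump_nonneg[of "c k" "r k" x] w_pos[of k]
    by (auto simp: f_def abs_mult intro: mult_left_le)
  have f'_le: "norm (f' k x v) \<le> 4 * w k * norm v" for k x v
  proof -
    have "\<bar>bump_grad (c k) (r k) x \<bullet> v\<bar> \<le> 4 * norm v"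
      by (rule order_trans[OF Cauchy_Schwarz_ineq2 mult_right_mono[OF norm_bump_grad_le[OF r]]]) simp
    then show ?thesis
      using w_pos[of k] by (simp add: f'_def abs_mult)
  qed
  have f_summable: "summable (\<lambda>k. f k x)" for x
    by (rule summable_comparison_test'[OF sums_summable[OF w_sums]]) (use f_le in auto)
  have w_v: "(\<lambda>k. 4 * w k * norm v) sums (\<epsilon> * norm v)" for v :: 'a
    using sums_mult2[OF sums_mult[OF w_sums, of 4], of "norm v"] by simp
  have f'_summable: "summable (\<lambda>k. norm (f' k x v))" for x v
    by (rule summable_comparison_test'[OF sums_summable[OF w_v, of v]]) (use f'_le in auto)
  define g' where "g' x v = (\<Sum>k. f' k x v)" for x v
  have unif: "\<forall>\<^sub>F n in sequentially. \<forall>x\<in>UNIV. \<forall>h. norm (sum (\<lambda>i. f' i x h) {..<n} - g' x h) \<le> e * norm h"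
    if "e > 0" for e
  proof -
    have "(\<lambda>n. \<Sum>k. 4 * w (k + n)) \<longlonglongrightarrow> 0"
      using suminf_exist_split2[of "\<lambda>k. 4 * w k"] w_sums[THEN sums_summable] by (simp add: summable_mult)
    then have "\<forall>\<^sub>F n in sequentially. (\<Sum>k. 4 * w (k + n)) < e"
      using that by (rule order_tendstoD)
    then show ?thesis
    proof (rule eventually_mono, safe)
      fix n x v assume n: "(\<Sum>k. 4 * w (k + n)) < e"
      have sw: "summable (\<lambda>k. 4 * w (k + n))"
        by (rule summable_mult[OF summable_ignore_initial_segment[OF sums_summable[OF w_sums]]])
      have sn: "summable (\<lambda>k. norm (f' (k + n) x v))"
        by (rule summable_ignore_initial_segment[OF f'_summable])
      have "norm (sum (\<lambda>i. f' i x v) {..<n} - g' x v) = norm (\<Sum>k. f' (k + n) x v)"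
        using suminf_minus_initial_segment[OF summable_norm_cancel[OF f'_summable[of x v]], of n]
        by (simp add: g'_def norm_minus_commute)
      also have "\<dots> \<le> (\<Sum>k. norm (f' (k + n) x v))"
        by (rule summable_norm[OF sn])
      also have "\<dots> \<le> (\<Sum>k. 4 * w (k + n) * norm v)"
        by (rule suminf_le[OF _ sn summable_mult2[OF sw]]) (use f'_le in auto)
      also have "\<dots> = (\<Sum>k. 4 * w (k + n)) * norm v"
        by (rule suminf_mult2[OF sw, symmetric])
      also have "\<dots> \<le> e * norm v"
        using n by (intro mult_right_mono) auto
      finally show "norm (sum (\<lambda>i. f' i x v) {..<n} - g' x v) \<le> e * norm v" .
    qed
  qed
  have "\<exists>g. \<forall>x\<in>UNIV. (\<lambda>k. f k x) sums g x \<and> (g has_derivative g' x) (at x within UNIV)"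
  proof (rule has_derivative_series[OF convex_UNIV _ unif])
    show "(f k has_derivative f' k x) (at x within UNIV)" for k x
      using has_derivative_mult_right[OF has_derivative_bump, of "w k"]
      by (simp add: f_def[abs_def] f'_def[abs_def])
    show "(\<lambda>k. f k 0) sums (\<Sum>k. f k 0)" by (rule summable_sums[OF f_summable])
  qed auto
  then obtain g where g: "\<And>x. (\<lambda>k. f k x) sums g x" "\<And>x. (g has_derivative g' x) (at x)"
    by auto
  have g_eq: "g x = (\<Sum>k. f k x)" for x using g(1) sums_unique by blast
  have f_nn: "0 \<le> f k x" for k x
    unfolding f_def by (intro mult_nonneg_nonneg bump_nonneg less_imp_le[OF w_pos])
  show thesis
  proof (rule that[OF g(2)])
    show "\<bar>g' x v\<bar> \<le> \<epsilon> * norm v" for x v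
    proof -
      have "\<bar>g' x v\<bar> \<le> (\<Sum>k. norm (f' k x v))"
        unfolding g'_def using summable_norm[OF f'_summable] by simp
      also have "\<dots> \<le> \<epsilon> * norm v"
        unfolding sums_unique[OF w_v]
        by (rule suminf_le[OF f'_le f'_summable sums_summable[OF w_v]])
      finally show ?thesis .
    qed
    show "0 \<le> g x" for x
      unfolding g_eq by (rule suminf_nonneg[OF f_summable f_nn])
    show "g x = 0 \<longleftrightarrow> x \<in> T" for x
    proof -
      have "g x = 0 \<longleftrightarrow> (\<forall>k. f k x = 0)"
        unfolding g_eq by (rule suminf_eq_zero_iff[OF f_summable f_nn])
      also have "\<dots> \<longleftrightarrow> x \<notin> (\<Union>k. ball (c k) (r k))"
        using less_imp_neq[OF w_pos] by (simp add: f_def bump_eq_0_iff[OF r(1)])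
      also have "\<dots> \<longleftrightarrow> x \<in> T"
        unfolding Un by simp
      finally show ?thesis .
    qed
  qed
qed

section \<open>Lipschitz maps and quasiregularity\<close>

lemma has_derivative_imp_difference_quotients:
  fixes f :: "'a::real_normed_vector \<Rightarrow> 'b::real_normed_vector"
  assumes "(f has_derivative f') (at x)" "t \<longlonglongrightarrow> 0" "\<And>k. t k \<noteq> 0"
  shows "(\<lambda>k. (f (x + t k *\<^sub>R v) - f x) /\<^sub>R t k) \<longlonglongrightarrow> f' v"
proof -
  have "((\<lambda>s. f (x + s *\<^sub>R v)) has_derivative (\<lambda>s. f' (s *\<^sub>R v))) (at 0)"
    by (rule has_derivative_compose[where g = f]) (auto intro!: derivative_eq_intros assms(1))
  then have "((\<lambda>s. f (x + s *\<^sub>R v)) has_vector_derivative f' v) (at 0)"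
    using linear_scale[OF has_derivative_linear[OF assms(1)]]
    by (simp add: has_vector_derivative_def)
  then have "((\<lambda>s. norm (f (x + s *\<^sub>R v) - f x - s *\<^sub>R f' v) / \<bar>s\<bar>) \<longlongrightarrow> 0) (at 0)"
    by (simp add: has_vector_derivative_def has_derivative_at)
  moreover have "norm (f (x + s *\<^sub>R v) - f x - s *\<^sub>R f' v) / \<bar>s\<bar> =
      norm ((f (x + s *\<^sub>R v) - f x) /\<^sub>R s - f' v)" if "s \<noteq> 0" for s
  proof -
    have "(f (x + s *\<^sub>R v) - f x) /\<^sub>R s - f' v = (f (x + s *\<^sub>R v) - f x - s *\<^sub>R f' v) /\<^sub>R s"
      using that by (simp add: scaleR_diff_right)
    then show ?thesis
      by (simp add: divide_inverse mult.commute)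
  qed
  ultimately have "((\<lambda>s. norm ((f (x + s *\<^sub>R v) - f x) /\<^sub>R s - f' v)) \<longlongrightarrow> 0) (at 0)"
    by (elim Lim_transform_eventually) (auto simp: eventually_at_filter)
  then have "((\<lambda>s. (f (x + s *\<^sub>R v) - f x) /\<^sub>R s) \<longlongrightarrow> f' v) (at 0)"
    unfolding tendsto_norm_zero_iff LIM_zero_iff .
  moreover have "filterlim t (at 0) sequentially"
    using assms(2,3) by (simp add: filterlim_at)
  ultimately show ?thesis
    by (rule filterlim_compose)
qed

lemma norm_derivative_le_lipschitz:
  fixes f :: "'a::real_normed_vector \<Rightarrow> 'b::real_normed_vector"
  assumes L: "L-lipschitz_on UNIV f" and f': "(f has_derivative f') (at x)"
  shows "norm (f' v) \<le> L * norm v"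
proof -
  define t :: "nat \<Rightarrow> real" where "t k = inverse (real (Suc k))" for k
  have t_nz: "t k \<noteq> 0" for k
    by (auto simp: t_def field_simps)
  have t_lim: "t \<longlonglongrightarrow> 0"
    unfolding t_def by (rule LIMSEQ_inverse_real_of_nat)
  have "(\<lambda>k. norm ((f (x + t k *\<^sub>R v) - f x) /\<^sub>R t k)) \<longlonglongrightarrow> norm (f' v)"
    by (intro tendsto_norm has_derivative_imp_difference_quotients[OF f' t_lim t_nz])
  moreover have "norm ((f (x + t k *\<^sub>R v) - f x) /\<^sub>R t k) \<le> L * norm v" for k
  proof -
    have "norm (f (x + t k *\<^sub>R v) - f x) \<le> \<bar>t k\<bar> * (L * norm v)"
      using lipschitz_onD[OF L, of "x + t k *\<^sub>R v" x] by (simp add: dist_norm mult_ac)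
    then show ?thesis
      using t_nz[of k] by (simp only: norm_scaleR) (simp add: field_simps)
  qed
  ultimately show ?thesis
    by (intro LIMSEQ_le_const2) auto
qed

lemma integrable_lebesgue_continuous_compact_support:
  fixes f :: "'a::euclidean_space \<Rightarrow> real"
  assumes "continuous_on UNIV f" "\<And>x. norm x > R \<Longrightarrow> f x = 0"
  shows "integrable lebesgue f"
proof -
  have "integrable lborel (\<lambda>x. indicator (cball 0 R) x *\<^sub>R f x)"
    by (rule borel_integrable_compact) (use assms(1) continuous_on_subset in auto)
  also have "(\<lambda>x. indicator (cball 0 R) x *\<^sub>R f x) = f"
    using assms(2) by (auto simp: indicator_def fun_eq_iff not_le)
  finally show ?thesis
    using assms(1) by (subst integrable_completion) (auto intro: borel_measurable_continuous_onI)
qed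

lemma lebesgue_integral_translate:
  fixes f :: "'a::euclidean_space \<Rightarrow> real"
  assumes "continuous_on UNIV f"
  shows "(LINT x|lebesgue. f (x + c)) = (LINT x|lebesgue. f x)"
proof -
  have [measurable]: "f \<in> borel_measurable borel"
    using assms by (rule borel_measurable_continuous_onI)
  have "(LINT x|lebesgue. f x) = (LINT x|distr lborel borel ((+) c). f x)"
    by (simp add: integral_completion lborel_distr_plus)
  also have "\<dots> = (LINT x|lborel. f (c + x))"
    by (rule integral_distr) auto
  also have "\<dots> = (LINT x|lebesgue. f (x + c))"
    by (simp add: integral_completion add.commute)
  finally show ?thesis ..
qed

text \<open>
Integration by parts for difference quotients is nothing but translation invariance:
\[ \int f(x)\, \frac{\phi(x + te) - \phi(x)}{t}\,dx = \int \frac{f(x - te) - f(x)}{t}\, \phi(x)\,dx. \]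
Let $t \to 0$ by dominated convergence on both sides. On the left the quotients are bounded by the
mean value theorem for $\phi$, on the right by the Lipschitz constant of $f$, and the right-hand
quotients converge almost everywhere to minus the derivative of $f$.
\<close>
lemma lipschitz_integration_by_parts:
  fixes f \<phi> :: "'a::euclidean_space \<Rightarrow> real"
  assumes L: "L-lipschitz_on UNIV f"
    and f': "AE x in lebesgue. (f has_derivative f' x) (at x)"
    and f'_meas: "(\<lambda>x. f' x e) \<in> borel_measurable lebesgue"
    and \<phi>': "\<And>x. (\<phi> has_derivative \<phi>' x) (at x)"
    and \<phi>'_cont: "continuous_on UNIV (\<lambda>x. \<phi>' x e)"
    and supp: "\<And>x. norm x > R \<Longrightarrow> \<phi> x = 0"
  shows "(LINT x|lebesgue. f x * \<phi>' x e) = - (LINT x|lebesgue. f' x e * \<phi> x)"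
proof -
  have lip: "\<bar>f x - f y\<bar> \<le> L * norm (x - y)" for x y
    using lipschitz_onD[OF L] by (simp add: dist_norm)
  define t :: "nat \<Rightarrow> real" where "t k = inverse (real (Suc k))" for k
  have t_pos: "0 < t k" and t_le: "t k \<le> 1" for k
    by (auto simp: t_def field_simps)
  have t_lim: "t \<longlonglongrightarrow> 0"
    unfolding t_def by (rule LIMSEQ_inverse_real_of_nat)
  have f_cont: "continuous_on UNIV f"
    using L by (rule lipschitz_on_continuous_on)
  have \<phi>_cont: "continuous_on UNIV \<phi>"
    using \<phi>' by (meson continuous_at_imp_continuous_on has_derivative_continuous)
  have shift_cont: "continuous_on UNIV (\<lambda>x. g (x + c))" if "continuous_on UNIV g" for g :: "'a \<Rightarrow> real" and c
    by (rule continuous_on_compose2[OF that]) (auto intro!: continuous_intros)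
  have \<phi>'_supp: "\<phi>' x e = 0" if "norm x > R" for x
  proof -
    have "((\<lambda>_. 0) has_derivative (\<lambda>_. 0)) (at x)" by simp
    then have "(\<phi> has_derivative (\<lambda>_. 0)) (at x)"
      by (rule has_derivative_transform_within_open[where s = "{x. norm x > R}"])
         (use that supp in \<open>auto intro!: open_Collect_less continuous_intros\<close>)
    then show ?thesis
      using has_derivative_unique[OF \<phi>'] by metis
  qed
  obtain M where M: "\<And>x. \<bar>\<phi>' x e\<bar> \<le> M"
  proof -
    have "compact ((\<lambda>x. \<phi>' x e) ` cball 0 R)"
      by (intro compact_continuous_image compact_cball continuous_on_subset[OF \<phi>'_cont]) auto
    then obtain M where "\<forall>x\<in>cball 0 R. \<bar>\<phi>' x e\<bar> \<le> M"
      by (auto dest!: compact_imp_bounded simp: bounded_iff)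
    then have M: "\<bar>\<phi>' x e\<bar> \<le> M" if "norm x \<le> R" for x
      using that by simp
    show thesis
    proof (rule that)
      show "\<bar>\<phi>' x e\<bar> \<le> max M 0" for x
        using M[of x] \<phi>'_supp[of x] by (cases "norm x \<le> R") auto
    qed
  qed
  have \<phi>_quot: "\<bar>(\<phi> (x + s *\<^sub>R e) - \<phi> x) / s\<bar> \<le> M" if "s > 0" for x s
  proof -
    have "\<exists>r\<in>{0<..<s}. \<phi> (x + s *\<^sub>R e) - \<phi> (x + 0 *\<^sub>R e) = \<phi>' (x + r *\<^sub>R e) ((s - 0) *\<^sub>R e)"
      using that
    proof (rule mvt_simple)
      show "((\<lambda>r. \<phi> (x + r *\<^sub>R e)) has_derivative (\<lambda>h. \<phi>' (x + r *\<^sub>R e) (h *\<^sub>R e))) (at r within {0..s})" for r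
        by (rule has_derivative_compose[OF _ \<phi>']) (auto intro!: derivative_eq_intros)
    qed
    then obtain r where "\<phi> (x + s *\<^sub>R e) - \<phi> x = s * \<phi>' (x + r *\<^sub>R e) e"
      using linear_scale[OF has_derivative_linear[OF \<phi>']] by auto
    then show ?thesis
      using that M by simp
  qed
  \<comment> \<open>The two sides of the identity for difference quotients, with step t k.\<close>
  define A where "A k x = f x * ((\<phi> (x + t k *\<^sub>R e) - \<phi> x) / t k)" for k x
  define B where "B k x = ((f (x + (- t k) *\<^sub>R e) - f x) / t k) * \<phi> x" for k x
  \<comment> \<open>Steps are at most one, so this radius contains the supports of all quotients of phi.\<close>
  define S where "S = R + norm e"
  have far: "norm x > R" "norm (x + t k *\<^sub>R e) > R" if "norm x > S" for x k
  proof -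
    have *: "norm (t k *\<^sub>R e) \<le> norm e"
      using t_pos[of k] t_le[of k] by (simp add: mult_left_le_one_le)
    show "norm x > R"
      using that norm_ge_zero[of e] unfolding S_def by linarith
    show "norm (x + t k *\<^sub>R e) > R"
      using that * norm_diff_ineq[of x "t k *\<^sub>R e"] unfolding S_def by linarith
  qed
  have int1: "integrable lebesgue (\<lambda>x. f x * \<phi> (x + t k *\<^sub>R e))" for k
    by (rule integrable_lebesgue_continuous_compact_support[of _ S])
       (use far supp in \<open>auto intro!: continuous_intros f_cont shift_cont \<phi>_cont\<close>)
  have int2: "integrable lebesgue (\<lambda>x. f x * \<phi> x)"
    by (rule integrable_lebesgue_continuous_compact_support[of _ R])
       (use supp in \<open>auto intro!: continuous_intros f_cont \<phi>_cont\<close>)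
  have cont3: "continuous_on UNIV (\<lambda>x. f (x + (- t k) *\<^sub>R e) * \<phi> x)" for k
    by (intro continuous_intros shift_cont f_cont \<phi>_cont)
  have int3: "integrable lebesgue (\<lambda>x. f (x + (- t k) *\<^sub>R e) * \<phi> x)" for k
    by (rule integrable_lebesgue_continuous_compact_support[of _ R, OF cont3]) (use supp in auto)
  have AB: "integral\<^sup>L lebesgue (A k) = integral\<^sup>L lebesgue (B k)" for k
  proof -
    have "integral\<^sup>L lebesgue (A k) =
      (LINT x|lebesgue. (f x * \<phi> (x + t k *\<^sub>R e) - f x * \<phi> x) / t k)"
      by (simp add: A_def[abs_def] algebra_simps diff_divide_distrib)
    also have "\<dots> = ((LINT x|lebesgue. f x * \<phi> (x + t k *\<^sub>R e)) - (LINT x|lebesgue. f x * \<phi> x)) / t k"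
      using int1 int2 by simp
    also have "(LINT x|lebesgue. f x * \<phi> (x + t k *\<^sub>R e)) = (LINT x|lebesgue. f (x + (- t k) *\<^sub>R e) * \<phi> x)"
      using lebesgue_integral_translate[OF cont3[of k], of "t k *\<^sub>R e"] by simp
    also have "((LINT x|lebesgue. f (x + (- t k) *\<^sub>R e) * \<phi> x) - (LINT x|lebesgue. f x * \<phi> x)) / t k
      = (LINT x|lebesgue. (f (x + (- t k) *\<^sub>R e) * \<phi> x - f x * \<phi> x) / t k)"
      using int3 int2 by simp
    also have "\<dots> = integral\<^sup>L lebesgue (B k)"
      by (simp add: B_def[abs_def] algebra_simps diff_divide_distrib)
    finally show ?thesis .
  qed
  have meas: "g \<in> borel_measurable lebesgue" if "continuous_on UNIV g" for g :: "'a \<Rightarrow> real"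
    using that by (intro measurable_completion) (simp add: borel_measurable_continuous_onI)
  have limA: "(\<lambda>k. integral\<^sup>L lebesgue (A k)) \<longlonglongrightarrow> (LINT x|lebesgue. f x * \<phi>' x e)"
  proof (rule integral_dominated_convergence)
    show "(\<lambda>x. f x * \<phi>' x e) \<in> borel_measurable lebesgue"
      by (intro meas continuous_intros f_cont \<phi>'_cont)
    show "A k \<in> borel_measurable lebesgue" for k
      unfolding A_def using t_pos[of k]
      by (intro meas continuous_intros f_cont shift_cont \<phi>_cont) auto
    show "integrable lebesgue (\<lambda>x. indicator (cball 0 S) x *\<^sub>R (\<bar>f x\<bar> * M))"
    proof (subst integrable_completion)
      show "integrable lborel (\<lambda>x. indicator (cball 0 S) x *\<^sub>R (\<bar>f x\<bar> * M))"
        by (intro borel_integrable_compact compact_cball continuous_intros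
            continuous_on_subset[OF f_cont]) auto
      have "(\<lambda>x. \<bar>f x\<bar> * M) \<in> borel_measurable borel"
        by (intro borel_measurable_continuous_onI continuous_intros f_cont)
      then show "(\<lambda>x. indicator (cball 0 S) x *\<^sub>R (\<bar>f x\<bar> * M)) \<in> borel_measurable lborel"
        by (intro borel_measurable_scaleR borel_measurable_indicator) auto
    qed
    have "(\<lambda>k. A k x) \<longlonglongrightarrow> f x * \<phi>' x e" for x
      unfolding A_def
      using has_derivative_imp_difference_quotients[OF \<phi>' t_lim, of x e] t_pos
      by (intro tendsto_mult_left) (simp add: divide_inverse mult.commute order_less_imp_not_eq2)
    then show "AE x in lebesgue. (\<lambda>k. A k x) \<longlonglongrightarrow> f x * \<phi>' x e" by simp
    have "norm (A k x) \<le> indicator (cball 0 S) x *\<^sub>R (\<bar>f x\<bar> * M)" for k x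
    proof (cases "norm x > S")
      case True
      then show ?thesis using far[OF True] supp by (simp add: A_def)
    next
      case False
      then show ?thesis
        using mult_left_mono[OF \<phi>_quot[OF t_pos[of k], of x], of "\<bar>f x\<bar>"]
        by (simp add: A_def abs_mult)
    qed
    then show "AE x in lebesgue. norm (A k x) \<le> indicator (cball 0 S) x *\<^sub>R (\<bar>f x\<bar> * M)" for k
      by simp
  qed
  have limB: "(\<lambda>k. integral\<^sup>L lebesgue (B k)) \<longlonglongrightarrow> (LINT x|lebesgue. - f' x e * \<phi> x)"
  proof (rule integral_dominated_convergence)
    show "(\<lambda>x. - f' x e * \<phi> x) \<in> borel_measurable lebesgue"
      using f'_meas meas[OF \<phi>_cont] by simp
    show "B k \<in> borel_measurable lebesgue" for k
      unfolding B_def using t_pos[of k]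
      by (intro meas continuous_intros f_cont shift_cont \<phi>_cont) auto
    show "integrable lebesgue (\<lambda>x. L * norm e * \<bar>\<phi> x\<bar>)"
      by (rule integrable_lebesgue_continuous_compact_support[of _ R])
         (use supp in \<open>auto intro!: continuous_intros \<phi>_cont\<close>)
    show "AE x in lebesgue. (\<lambda>k. B k x) \<longlonglongrightarrow> - f' x e * \<phi> x"
      using f'
    proof eventually_elim
      case (elim x)
      have "(\<lambda>k. - ((f (x + (- t k) *\<^sub>R e) - f x) /\<^sub>R (- t k))) \<longlonglongrightarrow> - f' x e"
        by (intro tendsto_minus has_derivative_imp_difference_quotients[OF elim])
           (use t_lim t_pos in \<open>auto simp: order_less_imp_not_eq2 intro: tendsto_eq_intros\<close>)
      then show ?case
        unfolding B_def
        by (intro tendsto_mult_right) (simp add: divide_inverse mult.commute)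
    qed
    have "norm (B k x) \<le> L * norm e * \<bar>\<phi> x\<bar>" for k x
    proof -
      have "\<bar>(f (x + (- t k) *\<^sub>R e) - f x) / t k\<bar> \<le> L * norm e"
        using lip[of "x + (- t k) *\<^sub>R e" x] t_pos[of k] by (simp add: field_simps)
      then show ?thesis
        unfolding B_def real_norm_def abs_mult by (intro mult_right_mono) auto
    qed
    then show "AE x in lebesgue. norm (B k x) \<le> L * norm e * \<bar>\<phi> x\<bar>" for k
      by simp
  qed
  have "(LINT x|lebesgue. f x * \<phi>' x e) = (LINT x|lebesgue. - f' x e * \<phi> x)"
    using limA limB unfolding AB by (rule LIMSEQ_unique)
  then show ?thesis by simp
qed

lemma test_function_C1:
  assumes "test_function \<phi>"
  shows "(\<phi> has_derivative frechet_derivative \<phi> (at x)) (at x)" "continuous_on UNIV (partial j \<phi>)"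
proof -
  have "C_k (Suc 0) \<phi>"
    using assms by (simp only: test_function_def)
  then show "(\<phi> has_derivative frechet_derivative \<phi> (at x)) (at x)" "continuous_on UNIV (partial j \<phi>)"
    by (simp_all add: frechet_derivative_works)
qed

text \<open>
The entries of the weak derivative are defined as limits of difference quotients along a fixed
sequence. Such a pointwise limit is measurable no matter whether it exists everywhere, and almost
everywhere it is the classical partial derivative. The partial derivatives are bounded by the
Lipschitz constant, so they are locally integrable to every power.
\<close>
lemma lipschitz_imp_W1_loc:
  fixes f :: "real^'n::finite \<Rightarrow> real^'m::finite"
  assumes L: "L-lipschitz_on UNIV f"
    and f': "AE x in lebesgue. f differentiable (at x)"
  obtains D where "W1_loc p f D" "AE x in lebesgue. (f has_derivative (*v) (D x)) (at x)"
proof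
  have lip: "norm (f x - f y) \<le> L * norm (x - y)" for x y
    using lipschitz_onD[OF L] by (simp add: dist_norm)
  define t :: "nat \<Rightarrow> real" where "t k = inverse (real (Suc k))" for k
  have t_nz: "t k \<noteq> 0" for k
    by (auto simp: t_def field_simps)
  have t_lim: "t \<longlonglongrightarrow> 0"
    unfolding t_def by (rule LIMSEQ_inverse_real_of_nat)
  define Dc where "Dc i j x = lim (\<lambda>k. (f (x + t k *\<^sub>R axis j 1) $ i - f x $ i) / t k)" for i j x
  define D where "D x = (\<chi> i j. Dc i j x)" for x
  have D_entry: "D x $ i $ j = Dc i j x" for x i j
    by (simp add: D_def)
  have f_cont: "continuous_on UNIV f"
    using L by (rule lipschitz_on_continuous_on)
  have [measurable]: "f \<in> borel_measurable borel"
    using f_cont by (rule borel_measurable_continuous_onI)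
  have Dc_meas: "Dc i j \<in> borel_measurable lebesgue" for i j
  proof (rule measurable_completion)
    have "(\<lambda>x. (f (x + t k *\<^sub>R axis j 1) $ i - f x $ i) / t k) \<in> borel_measurable borel" for k
      using t_nz[of k]
      by (intro borel_measurable_continuous_onI continuous_intros continuous_on_compose2[OF f_cont]) auto
    then show "Dc i j \<in> borel_measurable lborel"
      unfolding Dc_def by (intro borel_measurable_lim_metric) simp
  qed
  show D: "AE x in lebesgue. (f has_derivative (*v) (D x)) (at x)"
    using f'
  proof eventually_elim
    case (elim x)
    then obtain g where g: "(f has_derivative g) (at x)"
      by (auto simp: differentiable_def)
    have "g (axis j 1) $ i = Dc i j x" for i j
      unfolding Dc_def
      using tendsto_vec_nth[OF has_derivative_imp_difference_quotients[OF g t_lim t_nz, of "axis j 1"], of i]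
      by (intro limI[symmetric]) (simp add: divide_inverse mult.commute)
    then have "matrix g = D x"
      by (simp add: matrix_def D_def)
    then have "(*v) (D x) = g"
      using has_derivative_linear[OF g] by (metis matrix_vector_mul(2))
    then show ?case
      using g by simp
  qed
  have D_meas: "D \<in> borel_measurable lebesgue"
    using Dc_meas
    by (subst borel_measurable_euclidean_space) (auto simp: Basis_vec_def inner_axis D_def)
  have Dc_le: "AE x in lebesgue. \<forall>i j. \<bar>Dc i j x\<bar> \<le> L"
    using D
  proof eventually_elim
    case (elim x)
    have "\<bar>Dc i j x\<bar> \<le> L" for i j
    proof -
      have "norm (D x *v axis j 1) \<le> L"
        using norm_derivative_le_lipschitz[OF L elim, of "axis j 1"] by simp
      then show ?thesis
        using component_le_norm_cart[of "D x *v axis j 1" i]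
        by (simp add: matrix_vector_mult_basis column_def D_entry)
    qed
    then show ?case by blast
  qed
  have loc_bounded: "set_integrable lebesgue C (\<lambda>x. norm (g x) ^ p)"
    if C: "compact C" and g: "g \<in> borel_measurable lebesgue"
      and le: "AE x in lebesgue. x \<in> C \<longrightarrow> norm (g x) \<le> K"
    for C K and g :: "real^'n \<Rightarrow> 'z::euclidean_space"
    unfolding set_integrable_def
  proof (rule Bochner_Integration.integrable_bound)
    have "C \<in> lmeasurable" using C by (rule lmeasurable_compact)
    then show "integrable lebesgue (\<lambda>x. indicator C x *\<^sub>R K ^ p)"
      by (intro integrable_scaleR_left integrable_real_indicator) (auto simp: fmeasurable_def)
    show "(\<lambda>x. indicator C x *\<^sub>R norm (g x) ^ p) \<in> borel_measurable lebesgue"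
      using g \<open>C \<in> lmeasurable\<close> by (auto intro!: borel_measurable_scaleR borel_measurable_power borel_measurable_norm)
    show "AE x in lebesgue. norm (indicator C x *\<^sub>R norm (g x) ^ p) \<le> norm (indicator C x *\<^sub>R K ^ p)"
      using le
    proof eventually_elim
      case (elim x)
      have "norm (g x) ^ p \<le> \<bar>K ^ p\<bar>" if "x \<in> C"
        using power_mono[OF elim[rule_format, OF that], of p] by simp
      then show ?case
        by (cases "x \<in> C") auto
    qed
  qed
  show "W1_loc p f D"
    unfolding W1_loc_def
  proof (intro conjI)
    show "L_loc p f"
      unfolding L_loc_def
    proof (intro conjI allI impI)
      show f_meas: "f \<in> borel_measurable lebesgue"
        by (intro measurable_completion) simp
      fix C :: "(real^'n) set" assume C: "compact C"
      have "compact (f ` C)"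
        by (intro compact_continuous_image continuous_on_subset[OF f_cont] C) auto
      then obtain K where "\<forall>x\<in>C. norm (f x) \<le> K"
        by (auto dest!: compact_imp_bounded simp: bounded_iff)
      then show "set_integrable lebesgue C (\<lambda>x. norm (f x) ^ p)"
        by (intro loc_bounded[OF C f_meas]) auto
    qed
    show "L_loc p D"
      unfolding L_loc_def
    proof (intro conjI allI impI D_meas)
      fix C :: "(real^'n) set" assume C: "compact C"
      show "set_integrable lebesgue C (\<lambda>x. norm (D x) ^ p)"
      proof (rule loc_bounded[OF C D_meas])
        show "AE x in lebesgue. x \<in> C \<longrightarrow> norm (D x) \<le> (\<Sum>i\<in>(UNIV::'m set). \<Sum>j\<in>(UNIV::'n set). L)"
          using Dc_le
        proof eventually_elim
          case (elim x)
          have "norm (D x) \<le> (\<Sum>i\<in>UNIV. \<Sum>j\<in>UNIV. \<bar>Dc i j x\<bar>)"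
            unfolding norm_vec_def[of "D x"]
            by (rule order_trans[OF L2_set_le_sum])
               (auto intro!: sum_mono order_trans[OF norm_le_l1_cart] simp: D_entry)
          also have "\<dots> \<le> (\<Sum>i\<in>(UNIV::'m set). \<Sum>j\<in>(UNIV::'n set). L)"
            using elim by (intro sum_mono) auto
          finally show ?case by simp
        qed
      qed
    qed
    show "weak_derivative f D"
      unfolding weak_derivative_def
    proof (intro allI impI)
      fix \<phi> :: "real^'n \<Rightarrow> real" and i :: 'm and j :: 'n
      assume \<phi>: "test_function \<phi>"
      then have "bounded (closure {x. \<phi> x \<noteq> 0})"
        by (simp add: test_function_def compact_imp_bounded)
      then obtain R where "\<And>x. x \<in> closure {x. \<phi> x \<noteq> 0} \<Longrightarrow> norm x \<le> R"
        by (auto simp: bounded_iff)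
      then have R: "\<And>x. norm x > R \<Longrightarrow> \<phi> x = 0"
        using closure_subset[of "{x. \<phi> x \<noteq> 0}"] by force
      have D_i: "AE x in lebesgue. ((\<lambda>x. f x $ i) has_derivative (\<lambda>v. (D x *v v) $ i)) (at x)"
        using D
        by eventually_elim (rule bounded_linear.has_derivative[OF bounded_linear_vec_nth])
      have D_ij: "(D x *v axis j 1) $ i = D x $ i $ j" for x
        by (simp add: matrix_vector_mult_basis column_def)
      have "(LINT x|lebesgue. f x $ i * frechet_derivative \<phi> (at x) (axis j 1))
        = - (LINT x|lebesgue. (D x *v axis j 1) $ i * \<phi> x)"
      proof (rule lipschitz_integration_by_parts[where L = L, OF _ D_i _ test_function_C1(1)[OF \<phi>] _ R])
        show "L-lipschitz_on UNIV (\<lambda>x. f x $ i)"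
        proof (rule lipschitz_onI)
          show "dist (f x $ i) (f y $ i) \<le> L * dist x y" for x y
            using component_le_norm_cart[of "f x - f y" i] lip[of x y]
            by (simp add: dist_norm)
        qed (rule lipschitz_on_nonneg[OF L])
        show "(\<lambda>x. (D x *v axis j 1) $ i) \<in> borel_measurable lebesgue"
          using Dc_meas by (simp add: D_ij D_entry)
        show "continuous_on UNIV (\<lambda>x. frechet_derivative \<phi> (at x) (axis j 1))"
          using test_function_C1(2)[OF \<phi>, of j] by (simp add: partial_def[abs_def])
      qed
      then show "(LINT x|lebesgue. f x $ i * partial j \<phi> x) = - (LINT x|lebesgue. D x $ i $ j * \<phi> x)"
        by (simp add: partial_def D_ij)
    qed
  qed
qed

text \<open>
A Lipschitz constant bounds the operator norm of the derivative, so a positive lower bound for the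
Jacobian determinant is enough for the distortion inequality.
\<close>
lemma lipschitz_imp_quasiregular:
  fixes f :: "real^'n::finite \<Rightarrow> real^'n"
  assumes L: "L-lipschitz_on UNIV f"
    and f': "AE x in lebesgue. (f has_derivative f' x) (at x) \<and> c \<le> det (matrix (f' x))"
    and "c > 0"
  shows "quasiregular f"
proof -
  have "AE x in lebesgue. f differentiable (at x)"
    using f' by eventually_elim (auto simp: differentiable_def)
  then obtain D where D: "W1_loc CARD('n) f D" "AE x in lebesgue. (f has_derivative (*v) (D x)) (at x)"
    using lipschitz_imp_W1_loc[OF L] by blast
  have "AE x in lebesgue. onorm ((*v) (D x)) ^ CARD('n) \<le> max 1 (\<bar>L\<bar> ^ CARD('n) / c) * det (D x)"
    using f' D(2)
  proof eventually_elim
    case (elim x)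
    then have "f' x = (*v) (D x)"
      using has_derivative_unique by blast
    then have det: "c \<le> det (D x)"
      using elim(1) by simp
    have "onorm ((*v) (D x)) \<le> \<bar>L\<bar>"
      using norm_derivative_le_lipschitz[OF L elim(2)]
      by (intro onorm_le) (meson abs_ge_self mult_right_mono norm_ge_zero order_trans)
    then have "onorm ((*v) (D x)) ^ CARD('n) \<le> \<bar>L\<bar> ^ CARD('n)"
      by (intro power_mono onorm_pos_le matrix_vector_mul_bounded_linear)
    also have "\<dots> = (\<bar>L\<bar> ^ CARD('n) / c) * c"
      using \<open>c > 0\<close> by simp
    also have "\<dots> \<le> max 1 (\<bar>L\<bar> ^ CARD('n) / c) * det (D x)"
      using det \<open>c > 0\<close> by (intro mult_mono) auto
    finally show ?case .
  qed
  moreover have "continuous_on UNIV f"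
    using L by (rule lipschitz_on_continuous_on)
  ultimately show ?thesis
    unfolding quasiregular_def using D(1) max.cobounded1 by blast
qed

section \<open>Winding in the complex plane\<close>

text \<open>
In polar coordinates this is $r e^{i\theta} \mapsto r e^{iN\theta}$.
\<close>
definition wind :: "nat \<Rightarrow> complex \<Rightarrow> complex" where
  "wind N z = of_real (norm z) * sgn z ^ N"

lemma norm_mult_sgn: "of_real (norm z) * sgn z = (z :: complex)"
  by (cases "z = 0") (auto simp: sgn_div_norm scaleR_conv_of_real field_simps)

lemma norm_sgn_le_1: "norm (sgn z :: complex) \<le> 1"
  by (simp add: norm_sgn)

lemma norm_wind: "norm (wind N z) = norm z"
  by (cases "z = 0") (auto simp: wind_def norm_mult norm_power norm_sgn)

lemma wind_scaleR: "c \<ge> 0 \<Longrightarrow> wind N (c *\<^sub>R z) = c *\<^sub>R wind N z"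
  by (cases "c = 0") (auto simp: wind_def sgn_scaleR scaleR_conv_of_real[symmetric])

text \<open>
The argument splits $W(z) - W(w)$ into a radial part, bounded by $|z - w|$, and the angular part
$|w|(\mathrm{sgn}(z)^N - \mathrm{sgn}(w)^N)$, where $|w|\,|\mathrm{sgn}(z) - \mathrm{sgn}(w)| \le 2|z - w|$. This form
covers the origin, where $W$ is in general not differentiable.
\<close>
lemma wind_lipschitz: "(1 + 2 * real N)-lipschitz_on UNIV (wind N)"
proof (rule lipschitz_onI)
  fix z w :: complex
  have "norm w * norm (sgn z - sgn w) = norm (of_real (norm w) * sgn z - w)"
    by (metis norm_mult norm_mult_sgn norm_of_real abs_norm_cancel right_diff_distrib)
  also have "of_real (norm w) * sgn z - w = of_real (norm w - norm z) * sgn z + (z - w)"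
    using norm_mult_sgn[of z] by (simp add: algebra_simps)
  also have "norm \<dots> \<le> \<bar>norm w - norm z\<bar> * 1 + norm (z - w)"
    by (rule order_trans[OF norm_triangle_ineq])
       (intro add_mono order_refl, unfold norm_mult norm_of_real, intro mult_left_mono norm_sgn_le_1, simp)
  also have "\<dots> \<le> 2 * norm (z - w)"
    using norm_triangle_ineq3[of w z] by (simp add: norm_minus_commute)
  finally have *: "norm w * norm (sgn z - sgn w) \<le> 2 * norm (z - w)" .
  have "wind N z - wind N w = of_real (norm z - norm w) * sgn z ^ N + of_real (norm w) * (sgn z ^ N - sgn w ^ N)"
    by (simp add: wind_def algebra_simps)
  also have "norm \<dots> \<le> \<bar>norm z - norm w\<bar> * norm (sgn z ^ N) + norm w * norm (sgn z ^ N - sgn w ^ N)"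
    by (rule order_trans[OF norm_triangle_ineq]) (simp add: norm_mult flip: of_real_diff)
  also have "\<dots> \<le> norm (z - w) * 1 + norm w * (N * norm (sgn z - sgn w))"
    by (intro add_mono mult_mono norm_power_diff norm_sgn_le_1 norm_triangle_ineq3)
       (auto simp: norm_power intro: power_le_one norm_sgn_le_1)
  also have "\<dots> = norm (z - w) + N * (norm w * norm (sgn z - sgn w))"
    by simp
  also have "\<dots> \<le> norm (z - w) + N * (2 * norm (z - w))"
    using * by (intro add_mono mult_left_mono) auto
  finally show "dist (wind N z) (wind N w) \<le> (1 + 2 * real N) * dist z w"
    by (simp add: dist_norm algebra_simps)
qed simp

text \<open>
The derivative at $z = |z| u$: the factor \<open>cnj u\<close> turns the radial direction into the real axis,
the tangential component is stretched by $N$, and $u^N$ turns the result into the direction of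
the image point.
\<close>
definition wind_deriv :: "nat \<Rightarrow> complex \<Rightarrow> complex \<Rightarrow> complex" where
  "wind_deriv N z v = sgn z ^ N * Complex (Re (cnj (sgn z) * v)) (N * Im (cnj (sgn z) * v))"

lemma sgn_cnj_sgn: "z \<noteq> 0 \<Longrightarrow> sgn z * cnj (sgn z) = 1"
  by (simp add: complex_norm_square[symmetric] norm_sgn)

lemma has_derivative_wind:
  assumes "z \<noteq> 0"
  shows "(wind N has_derivative wind_deriv N z) (at z)"
proof -
  define r where "r = norm z"
  define u where "u = sgn z"
  have r: "r > 0" using assms by (simp add: r_def)
  have u: "u * cnj u = 1" "z = of_real r * u"
    using assms by (simp_all add: u_def r_def sgn_cnj_sgn norm_mult_sgn)
  have n: "(norm has_derivative (\<lambda>v. Re (cnj u * v))) (at z)"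
    using has_derivative_norm[OF assms] by (simp add: u_def inner_complex_def mult.commute)
  have "((\<lambda>z. inverse (norm z) *\<^sub>R z) has_derivative
      (\<lambda>v. inverse r *\<^sub>R v + (- (inverse r * Re (cnj u * v) * inverse r)) *\<^sub>R z)) (at z)"
    using has_derivative_scaleR[OF Deriv.has_derivative_inverse[OF _ n] has_derivative_ident] assms
    unfolding r_def by simp
  moreover have "inverse r *\<^sub>R v + (- (inverse r * Re (cnj u * v) * inverse r)) *\<^sub>R z
      = u * (\<i> * of_real (Im (cnj u * v))) / of_real r" for v
  proof -
    define y where "y = cnj u * v"
    have "v = u * y"
      using u(1) by (simp add: y_def flip: mult.assoc)
    then have "inverse r *\<^sub>R v + (- (inverse r * Re y * inverse r)) *\<^sub>R z = u * (y - of_real (Re y)) / of_real r"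
      using r u(2) by (simp add: scaleR_conv_of_real field_simps)
    also have "y - of_real (Re y) = \<i> * of_real (Im y)"
      by (simp add: complex_eq_iff)
    finally show ?thesis
      by (simp add: y_def)
  qed
  ultimately have s: "(sgn has_derivative (\<lambda>v. u * (\<i> * of_real (Im (cnj u * v))) / of_real r)) (at z)"
    by (simp add: sgn_div_norm[abs_def])
  have "((\<lambda>z. of_real (norm z) * sgn z ^ N) has_derivative
    (\<lambda>v. of_real (norm z) * (of_nat N * (u * (\<i> * of_real (Im (cnj u * v))) / of_real r) * sgn z ^ (N - 1))
      + of_real (Re (cnj u * v)) * sgn z ^ N)) (at z)"
    by (intro has_derivative_mult has_derivative_power has_derivative_of_real n s)
  moreover have "of_real (norm z) * (of_nat N * (u * (\<i> * of_real (Im (cnj u * v))) / of_real r) * sgn z ^ (N - 1))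
      + of_real (Re (cnj u * v)) * sgn z ^ N = wind_deriv N z v" for v
  proof -
    define y where "y = cnj u * v"
    have "of_real r * (of_nat N * (u * (\<i> * of_real (Im y)) / of_real r) * u ^ (N - 1)) =
        of_nat N * (\<i> * of_real (Im y)) * u ^ N"
      using r by (cases N) auto
    moreover have "Complex (Re y) (N * Im y) = of_real (Re y) + of_nat N * (\<i> * of_real (Im y))"
      by (simp add: complex_eq_iff)
    ultimately show ?thesis
      unfolding wind_deriv_def u_def[symmetric] r_def[symmetric] y_def[symmetric]
      by (simp add: algebra_simps)
  qed
  ultimately show ?thesis
    by (simp add: wind_def[abs_def])
qed

text \<open>
Euler's identity for a map homogeneous of degree one.
\<close>
lemma wind_deriv_self: "wind_deriv N z z = wind N z"
proof -
  have "cnj (sgn z) * z = of_real (norm z)"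
    by (cases "z = 0") (auto simp: sgn_eq complex_norm_square[symmetric] power2_eq_square  field_simps)
  then show ?thesis
    by (simp add: wind_deriv_def wind_def complex_eq_iff)
qed

text \<open>
The left-hand side is the determinant of the derivative in the real basis $1, i$. Rotations do not
change it, so only the stretching by $N$ remains.
\<close>
lemma wind_deriv_area:
  assumes "z \<noteq> 0"
  shows "Re (wind_deriv N z 1) * Im (wind_deriv N z \<i>) - Re (wind_deriv N z \<i>) * Im (wind_deriv N z 1) = N"
proof -
  have *: "Re (p * v) * Im (p * w) - Re (p * w) * Im (p * v) = (norm p)\<^sup>2 * (Re v * Im w - Re w * Im v)" for p v w
    unfolding cmod_power2 by (simp add: algebra_simps power2_eq_square)
  have "(Re (sgn z))\<^sup>2 + (Im (sgn z))\<^sup>2 = 1"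
    unfolding cmod_power2[symmetric] using assms by (simp add: norm_sgn)
  then have "N * (Re (sgn z))\<^sup>2 + N * (Im (sgn z))\<^sup>2 = N"
    by (simp flip: distrib_left)
  then show ?thesis
    unfolding wind_deriv_def * using assms by (simp add: norm_power norm_sgn power2_eq_square algebra_simps)
qed

text \<open>
Dividing by the norm identifies the fibre over $w$ with the set of $N$-th roots of $w/|w|$.
\<close>
lemma card_wind_fibre:
  assumes "N > 0" "w \<noteq> 0"
  shows "card {z. wind N z = w} = N"
proof -
  have unit: "norm u = 1" if "u ^ N = sgn w" for u
  proof -
    have "norm u ^ N = 1 ^ N"
      using arg_cong[OF that, of norm] assms(2) by (simp add: norm_power norm_sgn)
    then show ?thesis
      by (rule power_eq_imp_eq_base) (use assms(1) in auto)
  qed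
  have sgn_eq: "sgn (of_real (norm w) * u) = u" if "u ^ N = sgn w" for u
    using unit[OF that] assms by (simp add: sgn_mult sgn_of_real) (simp add: sgn_div_norm)
  have "bij_betw (\<lambda>u. of_real (norm w) * u) {u. u ^ N = sgn w} {z. wind N z = w}"
  proof (rule bij_betwI[where g = sgn])
    have "wind N (of_real (norm w) * u) = w" if "u ^ N = sgn w" for u
      unfolding wind_def sgn_eq[OF that] that norm_mult unit[OF that] by (simp add: norm_mult_sgn)
    then show "(\<lambda>u. of_real (norm w) * u) \<in> {u. u ^ N = sgn w} \<rightarrow> {z. wind N z = w}"
      by blast
    have "sgn z ^ N = sgn w" if "wind N z = w" for z
    proof -
      have nz: "norm z = norm w"
        using norm_wind[of N z] that by simp
      have "of_real (norm w) * sgn z ^ N = of_real (norm w) * sgn w"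
        using that nz unfolding norm_mult_sgn by (simp add: wind_def)
      then show ?thesis
        using assms by simp
    qed
    then show "sgn \<in> {z. wind N z = w} \<rightarrow> {u. u ^ N = sgn w}"
      by blast
    show "sgn (of_real (norm w) * u) = u" if "u \<in> {u. u ^ N = sgn w}" for u
      using that sgn_eq by simp
    show "of_real (norm w) * sgn z = z" if "z \<in> {z. wind N z = w}" for z
      using that norm_mult_sgn[of z] norm_wind[of N z] by simp
  qed
  from bij_betw_same_card[OF this] show ?thesis
    using card_nth_roots[of "sgn w" N] assms by (simp add: sgn_zero_iff)
qed

section \<open>Plane maps acting on two coordinates\<close>

definition coord_plane :: "'n::finite \<Rightarrow> 'n \<Rightarrow> real^'n \<Rightarrow> complex" where
  "coord_plane a b x = Complex (x $ a) (x $ b)"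

definition coord_embed :: "'n::finite \<Rightarrow> 'n \<Rightarrow> complex \<Rightarrow> real^'n" where
  "coord_embed a b z = Re z *\<^sub>R axis a 1 + Im z *\<^sub>R axis b 1"

text \<open>
The map that acts as $F$ on the coordinates $a, b$ and as the identity on the others. Writing it
as the identity plus a correction, with \<open>coord_plane\<close> and \<open>coord_embed\<close> linear and adjoint to each
other, reduces its norm, Lipschitz constant, derivative and fibres to those of $F$ without any work
with components.
\<close>
definition plane_map :: "'n::finite \<Rightarrow> 'n \<Rightarrow> (complex \<Rightarrow> complex) \<Rightarrow> real^'n \<Rightarrow> real^'n" where
  "plane_map a b F x = x + coord_embed a b (F (coord_plane a b x) - coord_plane a b x)"

lemma bounded_linear_coord_plane: "bounded_linear (coord_plane a b)"
  by (auto intro!: linearI simp: linear_conv_bounded_linear[symmetric] coord_plane_def complex_eq_iff)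

lemma bounded_linear_coord_embed: "bounded_linear (coord_embed a b)"
  by (auto intro!: linearI simp: linear_conv_bounded_linear[symmetric] coord_embed_def algebra_simps)

lemmas coord_plane_linear = bounded_linear.linear[OF bounded_linear_coord_plane]
lemmas coord_embed_linear = bounded_linear.linear[OF bounded_linear_coord_embed]

lemma coord_plane_embed: "a \<noteq> b \<Longrightarrow> coord_plane a b (coord_embed a b z) = z"
  by (simp add: coord_plane_def coord_embed_def complex_eq_iff axis_def)

lemma inner_coord_embed: "x \<bullet> coord_embed a b z = coord_plane a b x \<bullet> z"
  by (simp add: coord_embed_def coord_plane_def inner_complex_def inner_add_right inner_axis mult.commute)

lemma norm_coord_embed: "a \<noteq> b \<Longrightarrow> norm (coord_embed a b z) = norm z"
  by (simp add: norm_eq_sqrt_inner inner_coord_embed coord_plane_embed)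

lemma norm_coord_plane_le: 
  assumes "a \<noteq> b"
  shows "norm (coord_plane a b x) \<le> norm x"
proof -
  have "(norm (coord_plane a b x))\<^sup>2 = x \<bullet> coord_embed a b (coord_plane a b x)"
    by (simp add: inner_coord_embed power2_norm_eq_inner)
  also have "\<dots> \<le> norm x * norm (coord_plane a b x)"
    using norm_cauchy_schwarz[of x] norm_coord_embed[OF assms] by metis
  finally show ?thesis
    by (cases "coord_plane a b x = 0") (auto simp: power2_eq_square)
qed

lemma norm_plane_map:
  assumes "a \<noteq> b" "\<And>z. norm (F z) = norm z"
  shows "norm (plane_map a b F x) = norm x"
proof -
  define z where "z = coord_plane a b x"
  define e where "e = coord_embed a b (F z - z)"
  have "x \<bullet> e = z \<bullet> (F z - z)" "e \<bullet> e = (F z - z) \<bullet> (F z - z)"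
    unfolding e_def z_def by (simp_all add: inner_coord_embed coord_plane_embed assms(1))
  then have "plane_map a b F x \<bullet> plane_map a b F x = x \<bullet> x + 2 * (z \<bullet> (F z - z)) + (F z - z) \<bullet> (F z - z)"
    unfolding plane_map_def z_def[symmetric] e_def[symmetric]
    by (simp add: inner_add_left inner_add_right inner_commute[of e x])
  also have "\<dots> = x \<bullet> x - z \<bullet> z + F z \<bullet> F z"
    by (simp add: inner_diff_left inner_diff_right inner_commute)
  also have "\<dots> = x \<bullet> x"
    using assms(2)[of z] by (simp add: norm_eq)
  finally show ?thesis
    by (simp add: norm_eq)
qed

lemma plane_map_scaleR:
  assumes "\<And>z. F (c *\<^sub>R z) = c *\<^sub>R F z"
  shows "plane_map a b F (c *\<^sub>R x) = c *\<^sub>R plane_map a b F x"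
proof -
  have "plane_map a b F (c *\<^sub>R x) = c *\<^sub>R x + coord_embed a b (c *\<^sub>R (F (coord_plane a b x) - coord_plane a b x))"
    by (simp only: plane_map_def linear_scale[OF coord_plane_linear] assms scaleR_diff_right)
  then show ?thesis
    by (simp only: plane_map_def linear_scale[OF coord_embed_linear] scaleR_add_right)
qed

lemma plane_map_lipschitz:
  assumes "a \<noteq> b" "L-lipschitz_on UNIV F"
  shows "(L + 2)-lipschitz_on UNIV (plane_map a b F)"
proof (rule lipschitz_onI)
  show "0 \<le> L + 2" using lipschitz_on_nonneg[OF assms(2)] by simp
  fix x y
  define z w where "z = coord_plane a b x" and "w = coord_plane a b y"
  have zw: "norm (z - w) \<le> norm (x - y)"
    unfolding z_def w_def using norm_coord_plane_le[OF assms(1), of "x - y"]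
    by (simp add: linear_diff[OF coord_plane_linear])
  have "plane_map a b F x - plane_map a b F y = (x - y) + coord_embed a b ((F z - F w) - (z - w))"
    by (simp add: plane_map_def z_def w_def linear_diff[OF coord_embed_linear])
  also have "norm \<dots> \<le> norm (x - y) + norm ((F z - F w) - (z - w))"
    by (rule order_trans[OF norm_triangle_ineq]) (simp add: norm_coord_embed assms(1))
  also have "\<dots> \<le> norm (x - y) + (L * norm (z - w) + norm (z - w))"
    using lipschitz_onD[OF assms(2), of z w] norm_triangle_ineq4[of "F z - F w" "z - w"]
    by (simp add: dist_norm)
  also have "\<dots> \<le> norm (x - y) + (L * norm (x - y) + norm (x - y))"
    using zw lipschitz_on_nonneg[OF assms(2)] by (intro add_mono mult_left_mono order_refl)
  finally show "dist (plane_map a b F x) (plane_map a b F y) \<le> (L + 2) * dist x y"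
    by (simp add: dist_norm algebra_simps)
qed

lemma has_derivative_plane_map:
  assumes "(F has_derivative F') (at (coord_plane a b x))"
  shows "(plane_map a b F has_derivative plane_map a b F') (at x)"
proof -
  have 1: "(coord_plane a b has_derivative coord_plane a b) (at x)"
    by (rule bounded_linear_imp_has_derivative[OF bounded_linear_coord_plane])
  have "((\<lambda>x. x + coord_embed a b (F (coord_plane a b x) - coord_plane a b x)) has_derivative
    (\<lambda>v. v + coord_embed a b (F' (coord_plane a b v) - coord_plane a b v))) (at x)"
    by (intro has_derivative_add has_derivative_ident has_derivative_diff 1
        bounded_linear.has_derivative[OF bounded_linear_coord_embed] has_derivative_compose[OF 1 assms])
  then show ?thesis
    by (simp only: plane_map_def[abs_def])
qed

text \<open>
All rows of the matrix other than $a$ and $b$ are rows of the identity matrix. Hence in the Leibniz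
formula only the permutations supported in $\{a, b\}$ contribute: the identity and the
transposition.
\<close>
lemma det_plane_map:
  fixes a b :: "'n::finite"
  assumes "a \<noteq> b"
  shows "det (matrix (plane_map a b A)) = Re (A 1) * Im (A \<i>) - Re (A \<i>) * Im (A 1)"
proof -
  define M where "M = matrix (plane_map a b A)"
  have M: "M $ i $ j = (axis j 1 + coord_embed a b (A (coord_plane a b (axis j 1)) - coord_plane a b (axis j 1))) $ i" for i j
    by (simp add: M_def matrix_def plane_map_def)
  have pl: "coord_plane a b (axis a 1) = 1" "coord_plane a b (axis b 1) = \<i>"
    using assms by (auto simp: coord_plane_def axis_def complex_eq_iff)
  have M_ab: "M $ a $ a = Re (A 1)" "M $ a $ b = Re (A \<i>)" "M $ b $ a = Im (A 1)" "M $ b $ b = Im (A \<i>)"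
    using assms by (simp_all add: M pl coord_embed_def) (simp_all add: axis_def)
  have M_id: "M $ i $ j = (if i = j then 1 else 0)" if "i \<noteq> a" "i \<noteq> b" for i j
    using that by (simp add: M coord_embed_def) (simp add: axis_def)
  have off: "(\<Prod>i\<in>UNIV. M $ i $ p i) = 0" if p: "p permutes UNIV" "\<not> p permutes {a, b}" for p
  proof -
    obtain i where "i \<noteq> a" "i \<noteq> b" "p i \<noteq> i"
      using p by (auto simp: permutes_def)
    then have "M $ i $ p i = 0"
      by (simp add: M_id)
    then show ?thesis
      by (intro prod_zero) auto
  qed
  have on: "(\<Prod>i\<in>UNIV. M $ i $ p i) = M $ a $ p a * M $ b $ p b" if "p permutes {a, b}" for p
  proof -
    have "(\<Prod>i\<in>UNIV. M $ i $ p i) = (\<Prod>i\<in>{a, b}. M $ i $ p i)"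
      using that by (intro prod.mono_neutral_right) (auto simp: M_id permutes_not_in)
    then show ?thesis using assms by simp
  qed
  have "det M = (\<Sum>p | p permutes {a, b}. of_int (sign p) * (\<Prod>i\<in>UNIV. M $ i $ p i))"
    unfolding det_def
    by (rule sum.mono_neutral_right) (auto simp: finite_permutations off intro: permutes_subset)
  also have "\<dots> = (\<Sum>p\<in>{id, Transposition.transpose a b}. of_int (sign p) * (M $ a $ p a * M $ b $ p b))"
    by (intro sum.cong) (auto simp: permutes_doubleton_iff on)
  also have "\<dots> = M $ a $ a * M $ b $ b - M $ a $ b * M $ b $ a"
  proof -
    have "id \<noteq> Transposition.transpose a b"
      using assms by (metis id_apply transpose_apply_first)
    then show ?thesis
      using assms by (simp add: sign_id sign_swap_id)
  qed
  finally show ?thesis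
    by (simp only: M_ab) (simp add: M_def)
qed

text \<open>
The other coordinates of a preimage are those of $y$, so it is determined by its two coordinates
in the plane.
\<close>
lemma bij_betw_plane_map_fibre:
  assumes "a \<noteq> b"
  shows "bij_betw (coord_plane a b) {x. plane_map a b F x = y} {z. F z = coord_plane a b y}"
proof (rule bij_betwI[where g = "\<lambda>z. y + coord_embed a b (z - coord_plane a b y)"])
  note lin = linear_add[OF coord_plane_linear] linear_diff[OF coord_plane_linear]
    linear_add[OF coord_embed_linear] linear_diff[OF coord_embed_linear] coord_plane_embed[OF assms]
  have pl: "coord_plane a b (plane_map a b F x) = F (coord_plane a b x)" for x
    by (simp add: plane_map_def lin)
  show "coord_plane a b \<in> {x. plane_map a b F x = y} \<rightarrow> {z. F z = coord_plane a b y}"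
    using pl by auto
  show "(\<lambda>z. y + coord_embed a b (z - coord_plane a b y)) \<in> {z. F z = coord_plane a b y} \<rightarrow> {x. plane_map a b F x = y}"
    by (auto simp: plane_map_def lin)
  show "y + coord_embed a b (coord_plane a b x - coord_plane a b y) = x" if "x \<in> {x. plane_map a b F x = y}" for x
    using that by (auto simp: pl) (simp add: plane_map_def lin)
  show "coord_plane a b (y + coord_embed a b (z - coord_plane a b y)) = z" for z
    by (simp add: lin)
qed

section \<open>Radial damping of a homogeneous norm-preserving map\<close>

text \<open>
A Lipschitz constant of $g$ below one makes $t \mapsto t|x| - g(tx)$ strictly increasing along rays;
the value $1/2$ keeps the later constants simple.
\<close>
locale radial_damping =
  fixes P :: "'a::euclidean_space \<Rightarrow> 'a" and g :: "'a \<Rightarrow> real" and \<epsilon> :: real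
  assumes norm_P: "norm (P x) = norm x"
    and P_scaleR: "c \<ge> 0 \<Longrightarrow> P (c *\<^sub>R x) = c *\<^sub>R P x"
    and g_lipschitz: "\<epsilon>-lipschitz_on UNIV g"
    and g_nonneg: "0 \<le> g x"
    and g_0: "g 0 = 0"
    and eps: "\<epsilon> \<le> 1/2"
begin

text \<open>
At the origin the quotient is $0/0 = 0$ by convention and $P(0) = 0$, so $h(0) = 0$.
\<close>
definition h :: "'a \<Rightarrow> 'a" where
  "h x = (1 - g x / norm x) *\<^sub>R P x"

lemma eps_nonneg: "0 \<le> \<epsilon>"
  using g_lipschitz by (rule lipschitz_on_nonneg)

lemma g_diff_le: "\<bar>g x - g y\<bar> \<le> \<epsilon> * norm (x - y)"
  using lipschitz_onD[OF g_lipschitz, of x y] by (simp add: dist_norm)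

lemma g_le: "g x \<le> \<epsilon> * norm x"
  using g_diff_le[of x 0] by (simp add: g_0)

lemma P_0: "P 0 = 0"
  using norm_P[of 0] by simp

lemma h_0: "h 0 = 0"
  by (simp add: h_def P_0)

lemma quotient_bounds: "0 \<le> g x / norm x" "g x / norm x \<le> \<epsilon>"
  using g_nonneg[of x] g_le[of x] eps_nonneg by (auto simp: divide_le_eq)

lemma norm_h: "norm (h x) = norm x - g x"
proof -
  have "norm (h x) = (1 - g x / norm x) * norm x"
    using quotient_bounds[of x] eps by (simp add: h_def norm_P)
  then show ?thesis
    by (cases "x = 0") (simp_all add: g_0 left_diff_distrib)
qed

lemma h_eq_0_iff: "h x = 0 \<longleftrightarrow> x = 0"
proof
  assume "h x = 0"
  then have "norm x \<le> \<epsilon> * norm x"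
    using norm_h[of x] g_le[of x] by simp
  also have "\<dots> \<le> 1/2 * norm x"
    using eps by (intro mult_right_mono) auto
  finally show "x = 0"
    by simp
qed (simp add: h_0)

text \<open>
The quotient $q = g/|x|$ need not be Lipschitz near the origin, but $|q(x) - q(y)|\,|y|$ is controlled by
$|x - y|$, because $q(x)|y| - q(y)|y| = q(x)(|y| - |x|) + (g(x) - g(y))$. The factor $|y| = |P(y)|$ is
just the one with which the difference of the quotients enters $h(x) - h(y)$.
\<close>
lemma h_lipschitz:
  assumes P: "L-lipschitz_on UNIV P"
  shows "(2 * L + 1)-lipschitz_on UNIV h"
proof (rule lipschitz_onI)
  have L: "0 \<le> L" using P by (rule lipschitz_on_nonneg)
  then show "0 \<le> 2 * L + 1" by simp
  fix x y
  define q where "q x = g x / norm x" for x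
  have q_norm: "q x * norm x = g x" for x
    by (cases "x = 0") (auto simp: q_def g_0)
  have q: "0 \<le> q x" "q x \<le> \<epsilon>" for x
    using quotient_bounds[of x] by (simp_all add: q_def)
  have P_diff: "norm (P x - P y) \<le> L * norm (x - y)"
    using lipschitz_onD[OF P, of x y] by (simp add: dist_norm)
  have "q x * norm y - q y * norm y = q x * (norm y - norm x) + (g x - g y)"
    using q_norm[of x] q_norm[of y] by (simp add: algebra_simps)
  then have "\<bar>q x - q y\<bar> * norm y = \<bar>q x * (norm y - norm x) + (g x - g y)\<bar>"
    by (metis abs_mult abs_norm_cancel left_diff_distrib)
  also have "\<dots> \<le> q x * \<bar>norm y - norm x\<bar> + \<bar>g x - g y\<bar>"
    using q[of x] by (intro order_trans[OF abs_triangle_ineq]) (simp add: abs_mult)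
  also have "\<dots> \<le> \<epsilon> * norm (x - y) + \<epsilon> * norm (x - y)"
    using q[of x] eps_nonneg norm_triangle_ineq3[of y x]
    by (intro add_mono mult_mono g_diff_le) (auto simp: norm_minus_commute)
  also have "\<dots> \<le> norm (x - y)"
    using mult_right_mono[OF eps norm_ge_zero[of "x - y"]] by simp
  finally have q_diff: "\<bar>q x - q y\<bar> * norm y \<le> norm (x - y)" .
  have "h x - h y = (1 - q x) *\<^sub>R (P x - P y) - (q x - q y) *\<^sub>R P y"
    by (simp add: h_def q_def algebra_simps)
  also have "norm \<dots> \<le> (1 - q x) * norm (P x - P y) + \<bar>q x - q y\<bar> * norm y"
    using q[of x] eps by (intro order_trans[OF norm_triangle_ineq4]) (simp add: norm_P)
  also have "\<dots> \<le> 1 * (L * norm (x - y)) + norm (x - y)"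
    using q[of x] eps L P_diff q_diff by (intro add_mono mult_mono) auto
  also have "\<dots> \<le> (2 * L + 1) * norm (x - y)"
    using L by (simp add: algebra_simps)
  finally show "dist (h x) (h y) \<le> (2 * L + 1) * dist x y"
    by (simp add: dist_norm)
qed

text \<open>
By the product rule $Dh(x) v = (1 - q) P'v - (q'v) P(x)$, and Euler's identity $P(x) = P'x$ turns this into
$P'$ applied to $Bv = (1 - q) v - (q'v) x$. Here $q \le \epsilon$, and $|q'v|\,|x| \le 2\epsilon |v|$ as the
gradient of $q$ is of order $\epsilon/|x|$; so $B$ is close to the identity.
\<close>
lemma has_derivative_h:
  assumes x: "x \<noteq> 0"
    and P': "(P has_derivative P') (at x)" "P' x = P x"
    and g': "(g has_derivative g') (at x)"
  obtains B where "linear B" "\<And>v. norm (B v - v) \<le> 3 * \<epsilon> * norm v" "(h has_derivative P' \<circ> B) (at x)"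
proof -
  define q' where "q' v = g' v / norm x - g x * (sgn x \<bullet> v) / (norm x)\<^sup>2" for v
  define B where "B v = (1 - g x / norm x) *\<^sub>R v - q' v *\<^sub>R x" for v
  have lin_g': "linear g'"
    using g' by (rule has_derivative_linear)
  have lin_P': "linear P'"
    using P'(1) by (rule has_derivative_linear)
  have q: "((\<lambda>x. g x / norm x) has_derivative q') (at x)"
    using x by (auto intro!: derivative_eq_intros g' has_derivative_norm simp: inner_commute q'_def[abs_def] field_simps power2_eq_square)
  have q'_lin: "linear q'"
    using q by (rule has_derivative_linear)
  show thesis
  proof
    show "linear B"
      by (rule linearI)
         (simp_all add: B_def linear_add[OF q'_lin] linear_scale[OF q'_lin] algebra_simps)
    show "norm (B v - v) \<le> 3 * \<epsilon> * norm v" for v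
    proof -
      have g'_le: "\<bar>g' v\<bar> \<le> \<epsilon> * norm v"
        using norm_derivative_le_lipschitz[OF g_lipschitz g'] by simp
      have "\<bar>q' v\<bar> * norm x \<le> (\<bar>g' v\<bar> / norm x + g x * \<bar>sgn x \<bullet> v\<bar> / (norm x)\<^sup>2) * norm x"
        unfolding q'_def using g_nonneg[of x]
        by (intro mult_right_mono order_trans[OF abs_triangle_ineq4]) (auto simp: abs_mult)
      also have "\<dots> = \<bar>g' v\<bar> + (g x / norm x) * \<bar>sgn x \<bullet> v\<bar>"
        using x by (simp add: field_simps power2_eq_square)
      also have "\<dots> \<le> \<epsilon> * norm v + \<epsilon> * norm v"
        using Cauchy_Schwarz_ineq2[of "sgn x" v] x quotient_bounds[of x]
        by (intro add_mono g'_le mult_mono) (auto simp: norm_sgn)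
      finally have q'_le: "\<bar>q' v\<bar> * norm x \<le> \<epsilon> * norm v + \<epsilon> * norm v" .
      have "B v - v = - ((g x / norm x) *\<^sub>R v + q' v *\<^sub>R x)"
        by (simp add: B_def algebra_simps)
      then have "norm (B v - v) = norm ((g x / norm x) *\<^sub>R v + q' v *\<^sub>R x)"
        by (simp only: norm_minus_cancel)
      also have "\<dots> \<le> (g x / norm x) * norm v + \<bar>q' v\<bar> * norm x"
        using g_nonneg[of x] by (intro order_trans[OF norm_triangle_ineq]) simp
      also have "\<dots> \<le> \<epsilon> * norm v + (\<epsilon> * norm v + \<epsilon> * norm v)"
        using quotient_bounds[of x] by (intro add_mono q'_le mult_right_mono) auto
      finally show ?thesis
        by (simp add: algebra_simps)
    qed
    have "(h has_derivative (\<lambda>v. (1 - g x / norm x) *\<^sub>R P' v + (0 - q' v) *\<^sub>R P x)) (at x)"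
      unfolding h_def[abs_def]
      by (intro has_derivative_scaleR has_derivative_diff has_derivative_const q P'(1))
    also have "(\<lambda>v. (1 - g x / norm x) *\<^sub>R P' v + (0 - q' v) *\<^sub>R P x) = P' \<circ> B"
      by (simp add: fun_eq_iff B_def linear_diff[OF lin_P'] linear_scale[OF lin_P'] P'(2))
    finally show "(h has_derivative P' \<circ> B) (at x)" .
  qed
qed

text \<open>
A point of the fibre of $h$ over $y$ is moved along its ray to norm $|y|$. This is injective because
$|h|$ is strictly increasing along rays, and surjective by the intermediate value theorem: on the
ray through $z$ with $|z| = |y|$, the function $t \mapsto t|z| - g(tz)$ is zero at $t = 0$ and, as
$\epsilon \le 1/2$, at least $|z|$ at $t = 2$.
\<close>
lemma bij_betw_fibre:
  assumes "y \<noteq> 0"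
  shows "bij_betw (\<lambda>x. (norm y / norm x) *\<^sub>R x) {x. h x = y} {x. P x = y}"
proof (intro bij_betw_imageI inj_onI equalityI subsetI)
  fix x z
  assume x: "x \<in> {x. h x = y}" and z: "z \<in> {x. h x = y}"
    and eq: "(norm y / norm x) *\<^sub>R x = (norm y / norm z) *\<^sub>R z"
  have nz: "x \<noteq> 0" "z \<noteq> 0"
    using x z assms by (auto simp: h_0)
  have "(1 / norm x) *\<^sub>R x = (1 / norm z) *\<^sub>R z"
    using arg_cong[OF eq, of "\<lambda>u. (1 / norm y) *\<^sub>R u"] assms by simp
  then have z_eq: "z = (norm z / norm x) *\<^sub>R x"
  proof -
    have "z = norm z *\<^sub>R ((1 / norm z) *\<^sub>R z)"
      using nz by simp
    also have "\<dots> = norm z *\<^sub>R ((1 / norm x) *\<^sub>R x)"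
      by (simp only: \<open>(1 / norm x) *\<^sub>R x = (1 / norm z) *\<^sub>R z\<close>)
    finally show ?thesis by simp
  qed
  \<comment> \<open>On a common ray g would have to vary as much as the norm does, which its Lipschitz constant rules out for distinct points.\<close>
  have "norm (x - z) = \<bar>norm x - norm z\<bar>"
  proof -
    have "x - z = (1 - norm z / norm x) *\<^sub>R x"
      using z_eq by (simp add: algebra_simps)
    then have "norm (x - z) = \<bar>(1 - norm z / norm x) * norm x\<bar>"
      by (simp only: norm_scaleR abs_mult abs_norm_cancel)
    also have "(1 - norm z / norm x) * norm x = norm x - norm z"
      using nz by (simp add: left_diff_distrib)
    finally show ?thesis .
  qed
  moreover have "norm x - g x = norm z - g z"
    using x z norm_h by (metis mem_Collect_eq)
  ultimately have "norm (x - z) \<le> \<epsilon> * norm (x - z)"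
    using g_diff_le[of x z] by (simp add: algebra_simps)
  also have "\<dots> \<le> 1/2 * norm (x - z)"
    using eps by (intro mult_right_mono) auto
  finally show "x = z" by simp
next
  fix z assume "z \<in> (\<lambda>x. (norm y / norm x) *\<^sub>R x) ` {x. h x = y}"
  then obtain x where x: "h x = y" and z: "z = (norm y / norm x) *\<^sub>R x"
    by auto
  have nz: "x \<noteq> 0"
    using x assms by (auto simp: h_0)
  have "norm y / norm x = 1 - g x / norm x"
    using norm_h[of x] x nz by (simp add: diff_divide_distrib)
  then have "P z = h x"
    unfolding z P_scaleR[OF divide_nonneg_nonneg[OF norm_ge_zero norm_ge_zero]] by (simp add: h_def)
  then show "z \<in> {x. P x = y}"
    using x by simp
next
  fix z assume "z \<in> {x. P x = y}"
  then have Pz: "P z = y" by simp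
  then have nz: "norm z = norm y" "z \<noteq> 0"
    using norm_P[of z] assms by auto
  have "continuous_on UNIV g"
    using g_lipschitz by (rule lipschitz_on_continuous_on)
  then have "continuous_on {0..2} (\<lambda>t. g (t *\<^sub>R z))"
    by (rule continuous_on_compose2) (auto intro!: continuous_intros)
  then have "continuous_on {0..2} (\<lambda>t. t * norm z - g (t *\<^sub>R z))"
    by (intro continuous_intros)
  moreover have "norm z \<le> 2 * norm z - g (2 *\<^sub>R z)"
    using g_le[of "2 *\<^sub>R z"] mult_right_mono[OF eps, of "2 * norm z"] by simp
  ultimately obtain t where t: "0 \<le> t" "t * norm z - g (t *\<^sub>R z) = norm z"
    using IVT'[of "\<lambda>t. t * norm z - g (t *\<^sub>R z)" 0 "norm z" 2] by (auto simp: g_0)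
  have "t \<noteq> 0"
  proof
    assume "t = 0"
    then have "norm z = 0" using t(2) by (simp add: g_0)
    then show False using nz(2) by simp
  qed
  with t(1) have t_pos: "t > 0" by simp
  have "h (t *\<^sub>R z) = ((1 - g (t *\<^sub>R z) / (t * norm z)) * t) *\<^sub>R P z"
    using t_pos by (simp add: h_def P_scaleR)
  also have "(1 - g (t *\<^sub>R z) / (t * norm z)) * t = (t * norm z - g (t *\<^sub>R z)) / norm z"
    using t_pos nz(2) by (simp add: field_simps)
  also have "\<dots> = 1"
    using nz(2) by (simp add: t(2))
  finally have "h (t *\<^sub>R z) = y"
    using Pz by simp
  moreover have "z = (norm y / norm (t *\<^sub>R z)) *\<^sub>R (t *\<^sub>R z)"
    using t_pos assms nz by simp
  ultimately show "z \<in> (\<lambda>x. (norm y / norm x) *\<^sub>R x) ` {x. h x = y}"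
    by blast
qed

lemma max_modulus_h:
  assumes "\<And>r. 0 \<le> r \<Longrightarrow> \<exists>x. norm x = r \<and> g x = 0" "0 \<le> r"
  shows "(SUP x\<in>sphere 0 r. norm (h x)) = r"
proof (rule cSup_eq_maximum)
  show "r \<in> (\<lambda>x. norm (h x)) ` sphere 0 r"
    using assms(1)[OF assms(2)] by (force simp: norm_h)
  show "s \<le> r" if "s \<in> (\<lambda>x. norm (h x)) ` sphere 0 r" for s
    using that g_nonneg by (auto simp: norm_h)
qed

end

section \<open>Determinants and degree\<close>

text \<open>
Continuity of the determinant, in a form that speaks of linear maps and the norm of $Bv - v$.
\<close>
lemma det_near_identity:
  obtains \<delta> where "\<delta> > 0"
    "\<And>B :: real^'n::finite \<Rightarrow> real^'n. (\<And>v. norm (B v - v) \<le> \<delta> * norm v) \<Longrightarrow> det (matrix B) \<ge> 1/2"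
proof -
  have "continuous_on UNIV (det :: real^'n^'n \<Rightarrow> real)"
    unfolding det_def[abs_def] by (intro continuous_intros)
  then have "isCont (det :: real^'n^'n \<Rightarrow> real) (mat 1)"
    by (simp add: continuous_on_eq_continuous_at)
  then obtain \<eta> where \<eta>: "\<eta> > 0" "\<And>M :: real^'n^'n. dist M (mat 1) < \<eta> \<Longrightarrow> dist (det M) (det (mat 1 :: real^'n^'n)) < 1/2"
    unfolding continuous_at_eps_delta by (metis half_gt_zero zero_less_one)
  define n where "n = real CARD('n)"
  have n: "n > 0" by (simp add: n_def)
  show thesis
  proof
    show "\<eta> / (2 * n\<^sup>2) > 0" using \<eta>(1) n by simp
    fix B :: "real^'n \<Rightarrow> real^'n"
    assume B: "norm (B v - v) \<le> \<eta> / (2 * n\<^sup>2) * norm v" for v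
    have "\<bar>(matrix B - mat 1) $ i $ j\<bar> \<le> \<eta> / (2 * n\<^sup>2)" for i j
    proof -
      have "(matrix B - mat 1) $ i $ j = (B (axis j 1) - axis j 1) $ i"
        by (simp add: matrix_def mat_def axis_def)
      then show ?thesis
        using component_le_norm_cart[of "B (axis j 1) - axis j 1" i] B[of "axis j 1"] by simp
    qed
    then have "norm (matrix B - mat 1) \<le> (\<Sum>i\<in>(UNIV::'n set). \<Sum>j\<in>(UNIV::'n set). \<eta> / (2 * n\<^sup>2))"
      unfolding norm_vec_def[of "matrix B - mat 1"]
      by (intro order_trans[OF L2_set_le_sum] sum_mono order_trans[OF norm_le_l1_cart]) auto
    also have "\<dots> = \<eta> / 2"
      using n by (simp add: n_def[symmetric] power2_eq_square)
    also have "\<dots> < \<eta>" using \<eta>(1) by simp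
    finally have "dist (matrix B) (mat 1) < \<eta>" by (simp add: dist_norm)
    from \<eta>(2)[OF this] have "\<bar>det (matrix B) - 1\<bar> < 1/2"
      by (simp add: dist_real_def)
    then show "det (matrix B) \<ge> 1/2"
      by linarith
  qed
qed

lemma mapping_degree_eqI:
  assumes "\<And>y. finite (f -` {y}) \<and> card (f -` {y}) \<le> N" "card (f -` {y}) = N"
  shows "mapping_degree f = enat N"
  unfolding mapping_degree_def
proof (rule antisym)
  show "(SUP y. if finite (f -` {y}) then enat (card (f -` {y})) else \<infinity>) \<le> enat N"
    using assms(1) by (intro SUP_least) auto
  show "enat N \<le> (SUP y. if finite (f -` {y}) then enat (card (f -` {y})) else \<infinity>)"
    using assms by (intro SUP_upper2[of y]) auto
qed

section \<open>A quasiregular map with prescribed maximum modulus set\<close>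

theorem theorem1p1:
  fixes T :: "(real^'n::finite) set" and d :: nat
  assumes "CARD('n) \<ge> 2"
    and "closed T"
    and "\<And>r::real. r \<ge> 0 \<Longrightarrow> T \<inter> sphere 0 r \<noteq> {}"
    and "d \<ge> 1"
  shows "\<exists>h :: real^'n \<Rightarrow> real^'n. quasiregular h \<and> polynomial_type h \<and>
           mapping_degree h = enat (d ^ (CARD('n) - 1)) \<and> max_modulus_set h = T"
proof -
  define N where "N = d ^ (CARD('n) - 1)"
  have N: "N > 0" using assms(4) by (simp add: N_def)
  obtain a b :: 'n where ab: "a \<noteq> b"
    using assms(1) by (metis card_2_iff' ex_card UNIV_I subsetD)
  \<comment> \<open>The gradient bound must leave the factor B of the derivative of h with determinant at least 1/2.\<close>
  obtain \<delta> where \<delta>: "\<delta> > 0"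
    "\<And>B :: real^'n::finite \<Rightarrow> real^'n. (\<And>v. norm (B v - v) \<le> \<delta> * norm v) \<Longrightarrow> det (matrix B) \<ge> 1/2"
    using det_near_identity by metis
  define \<epsilon> where "\<epsilon> = min (1/2) (\<delta> / 3)"
  have \<epsilon>: "\<epsilon> > 0" "\<epsilon> \<le> 1/2" "3 * \<epsilon> \<le> \<delta>" using \<delta>(1) by (auto simp: \<epsilon>_def)
  obtain g g' where g: "\<And>x. (g has_derivative g' x) (at x)" "\<And>x v. \<bar>g' x v\<bar> \<le> \<epsilon> * norm v"
    "\<And>x. 0 \<le> g x" "\<And>x. g x = 0 \<longleftrightarrow> x \<in> T"
    using closed_set_as_zero_set[OF assms(2) \<epsilon>(1)] by metis
  have g_zero: "\<exists>x. norm x = r \<and> g x = 0" if "0 \<le> r" for r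
    using assms(3)[OF that] g(4) by auto
  define P where "P = plane_map a b (wind N)"
  interpret radial_damping P g \<epsilon>
  proof
    show "norm (P x) = norm x" for x
      unfolding P_def by (rule norm_plane_map[OF ab norm_wind])
    show "P (c *\<^sub>R x) = c *\<^sub>R P x" if "c \<ge> 0" for c x
      unfolding P_def by (intro plane_map_scaleR wind_scaleR that)
    show "\<epsilon>-lipschitz_on UNIV g"
    proof (rule lipschitz_onI)
      show "dist (g x) (g y) \<le> \<epsilon> * dist x y" for x y
        unfolding dist_norm
        by (rule differentiable_bound[of UNIV g g'])
           (use g(1,2) \<epsilon>(1) in \<open>auto intro!: onorm_le\<close>)
    qed (use \<epsilon>(1) in simp)
    show "g 0 = 0" using g_zero[of 0] by auto
  qed (use g(3) \<epsilon>(2) in auto)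
  have P_lip: "(1 + 2 * real N + 2)-lipschitz_on UNIV P"
    unfolding P_def by (rule plane_map_lipschitz[OF ab wind_lipschitz])
  have h_deriv: "\<exists>D. (h has_derivative D) (at x) \<and> 1/2 \<le> det (matrix D)" if "coord_plane a b x \<noteq> 0" for x
  proof -
    define P' where "P' = plane_map a b (wind_deriv N (coord_plane a b x))"
    have P': "(P has_derivative P') (at x)"
      unfolding P_def P'_def by (rule has_derivative_plane_map[OF has_derivative_wind[OF that]])
    have P'_self: "P' x = P x"
      by (simp add: P'_def P_def plane_map_def wind_deriv_self)
    have "x \<noteq> 0" using that by (auto simp: linear_0[OF coord_plane_linear])
    then obtain B where B: "linear B" "\<And>v. norm (B v - v) \<le> 3 * \<epsilon> * norm v" "(h has_derivative P' \<circ> B) (at x)"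
      using has_derivative_h[OF _ P' P'_self g(1)] by blast
    have "det (matrix B) \<ge> 1/2"
      using order_trans[OF B(2) mult_right_mono[OF \<epsilon>(3) norm_ge_zero]] by (intro \<delta>(2)) 
    moreover have "det (matrix P') = N"
      unfolding P'_def det_plane_map[OF ab] by (rule wind_deriv_area[OF that])
    moreover have "matrix (P' \<circ> B) = matrix P' ** matrix B"
      using B(1) has_derivative_linear[OF P'] by (intro matrix_compose)
    ultimately have "det (matrix (P' \<circ> B)) \<ge> 1 * (1/2)"
      unfolding det_mul using N by (simp only: det_mul) (intro mult_mono, auto)
    then show ?thesis using B(3) by auto
  qed
  \<comment> \<open>The exceptional subspace has codimension two; a hyperplane containing it is already a null set.\<close>
  have "AE x in lebesgue. coord_plane a b x \<noteq> 0"
  proof (rule AE_I')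
    have "negligible {x :: real^'n. x $ a = 0}"
      by (rule negligible_standard_hyperplane_cart)
    then show "{x :: real^'n. x $ a = 0} \<in> null_sets lebesgue"
      by (simp add: negligible_iff_null_sets)
  qed (auto simp: coord_plane_def complex_eq_iff)
  then have "AE x in lebesgue. (h has_derivative (SOME D. (h has_derivative D) (at x) \<and> 1/2 \<le> det (matrix D))) (at x)
      \<and> 1/2 \<le> det (matrix (SOME D. (h has_derivative D) (at x) \<and> 1/2 \<le> det (matrix D)))"
    by eventually_elim (rule someI_ex[OF h_deriv])
  then have qr: "quasiregular h"
    by (rule lipschitz_imp_quasiregular[OF h_lipschitz[OF P_lip]]) simp
  have card_P: "card {x. P x = y} = (if coord_plane a b y = 0 then 1 else N)" for y
  proof -
    have "card {x. P x = y} = card {z. wind N z = coord_plane a b y}"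
      unfolding P_def by (rule bij_betw_same_card[OF bij_betw_plane_map_fibre[OF ab]])
    moreover have "{z. wind N z = 0} = {0}"
    proof -
      have "wind N z = 0 \<longleftrightarrow> z = 0" for z
        by (metis norm_wind norm_eq_zero)
      then show ?thesis by simp
    qed
    ultimately show ?thesis
      using card_wind_fibre[OF N] by auto
  qed
  have card_h: "card (h -` {y}) = (if coord_plane a b y = 0 then 1 else N)" for y
  proof (cases "y = 0")
    case True
    have "h -` {y} = {0}"
      unfolding True vimage_singleton_eq set_eq_iff by (simp add: h_eq_0_iff)
    moreover have "coord_plane a b y = 0"
      unfolding True by (rule linear_0[OF coord_plane_linear])
    ultimately show ?thesis by simp
  next
    case False
    then show ?thesis
      using bij_betw_same_card[OF bij_betw_fibre[OF False]]
      unfolding card_P vimage_def by simp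
  qed
  have deg: "mapping_degree h = enat N"
  proof (rule mapping_degree_eqI)
    \<comment> \<open>A positive cardinality entails finiteness of the fibre.\<close>
    show "finite (h -` {y}) \<and> card (h -` {y}) \<le> N" for y
      using card_h[of y] N card_ge_0_finite[of "h -` {y}"] by auto
    \<comment> \<open>Every point off the exceptional subspace has N preimages, a unit vector of the plane for instance.\<close>
    show "card (h -` {axis a 1}) = N"
      using card_h[of "axis a 1"] ab by (auto simp: coord_plane_def axis_def complex_eq_iff)
  qed
  have "h 0 \<noteq> h (axis a 1)"
    by (simp add: h_0 eq_commute[of 0] h_eq_0_iff)
  then have "\<not> h constant_on UNIV"
    unfolding constant_on_def by (metis UNIV_I)
  then have "polynomial_type h"
    unfolding polynomial_type_def using qr deg by simp
  moreover have "max_modulus_set h = T"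
  proof -
    have "max_modulus (norm x) h = norm x" for x :: "real^'n"
      unfolding max_modulus_def by (rule max_modulus_h[OF g_zero]) auto
    then show ?thesis
      by (simp add: max_modulus_set_def norm_h g(4))
  qed
  ultimately show ?thesis
    using qr deg unfolding N_def by blast
qed

end
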